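(* Let $R$ be a ring. Then $R$ is strongly weakly nil-clean if and only if both of the following hold: (1) $R$ is weakly exchange; (2) $R$ is WUU.
   Context: All rings are associative with identity (not necessarily commutative). $N(R)$ denotes the set of nilpotent elements and $U(R)$ the group of units of $R$. A ring $R$ is strongly weakly nil-clean if every $a\in R$ is the sum or difference of a nilpotent and an idempotent that commute, i.e. there are a nilpotent $w\in R$ and an idempotent $e\in R$ with $we=ew$ and $a=w+e$ or $a=w-e$. A ring $R$ is weakly exchange if for every $a\in R$ there exists an idempotent $e\in R$ such that $e\in aR$ and $1-e\in (1-a)R\cup(1+a)R$. A ring $R$ is WUU if for every unit $u\in U(R)$ one has $u\in 1+N(R)$ or $u\in -1+N(R)$. *)

theory Defs
  imports "HOL-Algebra.Algebra"
begin

text \<open>In HOL-Algebra, \<^locale>\<open>ring\<close> means associative and unital, not necessarily commutative;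
  the zero ring is included.\<close>

text \<open>The exponent 0 adds nothing: \<open>1 = 0\<close> holds only in the zero ring.\<close>

definition nilpotents :: "('a, 'm) ring_scheme \<Rightarrow> 'a set"
  where "nilpotents R = {w \<in> carrier R. \<exists>n::nat. w [^]\<^bsub>R\<^esub> n = \<zero>\<^bsub>R\<^esub>}"

definition idempotents :: "('a, 'm) ring_scheme \<Rightarrow> 'a set"
  where "idempotents R = {e \<in> carrier R. e \<otimes>\<^bsub>R\<^esub> e = e}"

definition strongly_weakly_nil_clean :: "('a, 'm) ring_scheme \<Rightarrow> bool"
  where "strongly_weakly_nil_clean R \<longleftrightarrow>
    (\<forall>a \<in> carrier R. \<exists>w \<in> nilpotents R. \<exists>e \<in> idempotents R.
      w \<otimes>\<^bsub>R\<^esub> e = e \<otimes>\<^bsub>R\<^esub> w \<and> (a = w \<oplus>\<^bsub>R\<^esub> e \<or> a = w \<ominus>\<^bsub>R\<^esub> e))"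

text \<open>The multiplicative left coset \<open>a <#\<^bsub>R\<^esub> carrier R\<close> is the principal right ideal \<open>aR\<close>.\<close>

definition weakly_exchange :: "('a, 'm) ring_scheme \<Rightarrow> bool"
  where "weakly_exchange R \<longleftrightarrow>
    (\<forall>a \<in> carrier R. \<exists>e \<in> idempotents R.
      e \<in> a <#\<^bsub>R\<^esub> carrier R \<and>
      \<one>\<^bsub>R\<^esub> \<ominus>\<^bsub>R\<^esub> e \<in> ((\<one>\<^bsub>R\<^esub> \<ominus>\<^bsub>R\<^esub> a) <#\<^bsub>R\<^esub> carrier R) \<union> ((\<one>\<^bsub>R\<^esub> \<oplus>\<^bsub>R\<^esub> a) <#\<^bsub>R\<^esub> carrier R))"

text \<open>The additive cosets below are \<open>1 + N(R)\<close> and \<open>-1 + N(R)\<close>; \<^const>\<open>Units\<close> consists of the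
  two-sided units.\<close>

definition WUU :: "('a, 'm) ring_scheme \<Rightarrow> bool"
  where "WUU R \<longleftrightarrow>
    (\<forall>u \<in> Units R. u \<in> \<one>\<^bsub>R\<^esub> <+\<^bsub>R\<^esub> nilpotents R \<or> u \<in> (\<ominus>\<^bsub>R\<^esub> \<one>\<^bsub>R\<^esub>) <+\<^bsub>R\<^esub> nilpotents R)"

end

theory Submission
  imports Defs
begin

text \<open>
  Suppose first that \<open>R\<close> is strongly weakly nil-clean. If \<open>a = w + e\<close>, then \<open>a\<close> multiplies \<open>e\<close> to
  \<open>e (1 + w)\<close> and \<open>1 - a\<close> multiplies \<open>1 - e\<close> to \<open>(1 - e) (1 - w)\<close>; as \<open>1 + w\<close> and \<open>1 - w\<close> are
  units, \<open>e\<close> itself is the idempotent that the exchange property asks for. The case \<open>a = w - e\<close>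
  reduces to this one by passing to \<open>- a\<close>. If \<open>a\<close> is a unit, it commutes with \<open>w\<close>, so \<open>e\<close> is, up to
  sign, the unit \<open>a - w\<close>; a unit that is idempotent equals 1.

  For the converse it suffices that \<open>a - a\<^sup>2\<close> or \<open>a + a\<^sup>2\<close> is nilpotent for every \<open>a\<close>, since an
  element with \<open>a - a\<^sup>2\<close> nilpotent differs by a nilpotent from an idempotent that is a polynomial in
  it (\<open>lift_idempotent\<close>). The argument has four stages.

  \<^item> The central element 6 is nilpotent (\<open>six_nilpotent\<close>): exchange for 3 splits the identity into
    an idempotent divisible by 3 and one divisible by 2, so 3 acts as a unit on one piece and 2 on
    the other, and the condition on units bounds both pieces.

  \<^item> If \<open>b\<^sup>2 = 0\<close>, the right ideal \<open>bR\<close> contains no nonzero idempotent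
    (\<open>square_zero_no_idempotent\<close>). Such an idempotent would produce a system of two by two matrix
    units, hence the unit with rows (2, 1) and (1, 1); but the matrix \<open>z\<close> with rows (1, 1) and
    (1, 0) satisfies \<open>z\<^sup>2 = z + 1\<close>, which makes neither \<open>z\<close> nor \<open>z + 2\<close> nilpotent when 6 is
    nilpotent.

  \<^item> A right ideal without nonzero idempotents is nil (\<open>nilradical_if_no_idempotent\<close>). Hence the
    elements generating nil right ideals form a two-sided ideal \<open>K\<close>, and \<open>K\<close> contains every
    nilpotent, because the previous stage can be repeated modulo \<open>K\<close>.

  \<^item> Modulo \<open>K\<close> idempotents are central, since \<open>e r (1 - e)\<close> squares to zero. So the usual proof
    that an abelian exchange ring is clean applies: \<open>a - (1 - e)\<close> is a unit, up to replacing \<open>a\<close> by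
    \<open>- a\<close>, whence \<open>a\<close> is \<open>- e\<close> or \<open>2 - e\<close> modulo \<open>K\<close>. In the second case the unit \<open>1 - 2 e\<close> shows
    that \<open>2 e\<close> or \<open>2 (1 - e)\<close> lies in \<open>K\<close>, and then \<open>a + a\<^sup>2\<close> or \<open>a - a\<^sup>2\<close> does.
\<close>

text \<open>The right unit law joins the rewrite rules of the ring normalization: without commutativity
  the left unit law does not yield it.\<close>
lemmas (in ring) noncommutative_ring_normalization
  [algebra ring "ring.zero R" "ring.add R" "a_inv R" "a_minus R" "monoid.one R" "monoid.mult R"] = r_one

context ring
begin

section \<open>Double centralizers\<close>

text \<open>Computations in several commuting elements are carried out in their double centralizer, a
  commutative subring that contains them; it replaces the subring of polynomials in these elements.\<close>
definition centralizer :: "'a set \<Rightarrow> 'a set"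
  where "centralizer S = {x \<in> carrier R. \<forall>s \<in> S. x \<otimes> s = s \<otimes> x}"

lemma centralizer_closed: "x \<in> centralizer S \<Longrightarrow> x \<in> carrier R"
  by (simp add: centralizer_def)

lemma centralizer_commute: "x \<in> centralizer S \<Longrightarrow> s \<in> S \<Longrightarrow> x \<otimes> s = s \<otimes> x"
  unfolding centralizer_def by blast

lemma centralizer_one: "S \<subseteq> carrier R \<Longrightarrow> \<one> \<in> centralizer S"
  by (simp add: centralizer_def subset_iff)

lemma centralizer_add:
  "\<lbrakk>S \<subseteq> carrier R; x \<in> centralizer S; y \<in> centralizer S\<rbrakk> \<Longrightarrow> x \<oplus> y \<in> centralizer S"
  by (simp add: centralizer_def l_distr r_distr subset_iff)

lemma centralizer_uminus:
  "\<lbrakk>S \<subseteq> carrier R; x \<in> centralizer S\<rbrakk> \<Longrightarrow> \<ominus> x \<in> centralizer S"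
  by (simp add: centralizer_def l_minus r_minus subset_iff)

lemma centralizer_mult:
  assumes "S \<subseteq> carrier R" "x \<in> centralizer S" "y \<in> centralizer S"
  shows "x \<otimes> y \<in> centralizer S"
proof -
  have "x \<otimes> y \<otimes> s = s \<otimes> (x \<otimes> y)" if "s \<in> S" for s
  proof -
    have [simp]: "x \<in> carrier R" "y \<in> carrier R" "s \<in> carrier R"
      using that assms centralizer_closed by blast+
    have "x \<otimes> y \<otimes> s = x \<otimes> (s \<otimes> y)"
      by (simp add: m_assoc centralizer_commute[OF assms(3) that])
    also have "\<dots> = (s \<otimes> x) \<otimes> y"
      by (simp add: m_assoc[symmetric] centralizer_commute[OF assms(2) that])
    finally show ?thesis by (simp add: m_assoc)
  qed
  moreover have "x \<otimes> y \<in> carrier R"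
    using assms centralizer_closed by blast
  ultimately show ?thesis
    unfolding centralizer_def by blast
qed

lemma centralizer_pow:
  "\<lbrakk>S \<subseteq> carrier R; x \<in> centralizer S\<rbrakk> \<Longrightarrow> x [^] (n::nat) \<in> centralizer S"
  by (induction n) (auto simp: centralizer_one centralizer_mult)

lemma centralizer_subset: "centralizer S \<subseteq> carrier R"
  by (auto simp: centralizer_def)

lemma in_double_centralizer:
  "\<lbrakk>S \<subseteq> carrier R; x \<in> S\<rbrakk> \<Longrightarrow> x \<in> centralizer (centralizer S)"
  by (auto simp: centralizer_def)

lemma double_centralizer_commute:
  assumes "S \<subseteq> centralizer S" "x \<in> centralizer (centralizer S)" "y \<in> centralizer (centralizer S)"
  shows "x \<otimes> y = y \<otimes> x"
proof -
  have "y \<in> centralizer S"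
    using assms(1,3) unfolding centralizer_def by blast
  then show ?thesis
    by (rule centralizer_commute[OF assms(2)])
qed

text \<open>A binomial theorem reduced to what nilpotency arguments use: modulo \<open>y\<close>, the power
  \<open>(x + y)\<^sup>n\<close> is \<open>x\<^sup>n\<close>. With \<open>y = 1 - x\<close> it is the geometric sum. Keeping the cofactor in the
  centralizer of \<open>S\<close> allows it to be commuted with the other elements under consideration.\<close>
lemma pow_add_commuting:
  assumes S: "S \<subseteq> carrier R" and x: "x \<in> centralizer S" and y: "y \<in> centralizer S"
    and xy: "x \<otimes> y = y \<otimes> x"
  shows "\<exists>s \<in> centralizer S. (x \<oplus> y) [^] (n::nat) = x [^] n \<oplus> y \<otimes> s"
proof (induction n)
  case 0
  have "\<zero> \<in> centralizer S"
    using S by (simp add: centralizer_def subset_iff)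
  then show ?case
    using centralizer_closed[OF y] by (intro bexI[of _ \<zero>]) simp_all
next
  case (Suc n)
  then obtain s where s: "s \<in> centralizer S" "(x \<oplus> y) [^] n = x [^] n \<oplus> y \<otimes> s"
    by blast
  have [simp]: "x \<in> carrier R" "y \<in> carrier R" "s \<in> carrier R"
    using x y s(1) by (simp_all only: centralizer_closed)
  have c: "x [^] n \<otimes> y = y \<otimes> x [^] n"
    using xy by (intro group_commutes_pow) simp_all
  have "(x \<oplus> y) [^] Suc n = x [^] n \<otimes> x \<oplus> x [^] n \<otimes> y \<oplus> y \<otimes> (s \<otimes> (x \<oplus> y))"
    unfolding nat_pow_Suc s(2) by (simp add: ring_simprules)
  also have "\<dots> = x [^] Suc n \<oplus> y \<otimes> (x [^] n \<oplus> s \<otimes> (x \<oplus> y))"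
    unfolding c by (simp add: ring_simprules)
  finally show ?case
    by (rule bexI) (intro centralizer_add centralizer_mult centralizer_pow S x y s(1))
qed

section \<open>Nilpotents and idempotents\<close>

lemma nilpotents_closed [simp]: "w \<in> nilpotents R \<Longrightarrow> w \<in> carrier R"
  unfolding nilpotents_def by blast

lemma idempotents_closed [simp]: "e \<in> idempotents R \<Longrightarrow> e \<in> carrier R"
  unfolding idempotents_def by blast

lemma idempotents_idem: "e \<in> idempotents R \<Longrightarrow> e \<otimes> e = e"
  unfolding idempotents_def by blast

lemma nilpotentsI: "\<lbrakk>w \<in> carrier R; w [^] (n::nat) = \<zero>\<rbrakk> \<Longrightarrow> w \<in> nilpotents R"
  unfolding nilpotents_def by blast

lemma nilpotents_Suc:
  assumes "w \<in> nilpotents R" obtains n :: nat where "w [^] Suc n = \<zero>"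
proof -
  from assms obtain n :: nat where "w \<in> carrier R" "w [^] n = \<zero>"
    unfolding nilpotents_def by blast
  then have "w [^] Suc n = \<zero>" by simp
  then show thesis by (rule that)
qed

lemma nilpotent_mult_commuting:
  assumes "x \<in> nilpotents R" "y \<in> carrier R" "x \<otimes> y = y \<otimes> x"
  shows "x \<otimes> y \<in> nilpotents R"
proof -
  obtain n where "x [^] Suc n = \<zero>" using nilpotents_Suc assms(1) .
  then have "(x \<otimes> y) [^] Suc n = \<zero>"
    using pow_mult_distrib[OF assms(3), of "Suc n"] assms(1,2) by simp
  then show ?thesis by (rule nilpotentsI[rotated]) (simp add: assms(1,2))
qed

lemma nilpotent_uminus: "x \<in> nilpotents R \<Longrightarrow> \<ominus> x \<in> nilpotents R"
  using nilpotent_mult_commuting[of x "\<ominus> \<one>"] by (simp add: r_minus l_minus)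

text \<open>If \<open>x\<^sup>n = 0\<close>, then \<open>(x + y)\<^sup>n\<close> is a multiple of \<open>y\<close> by an element commuting with \<open>y\<close>, and so it
  is nilpotent.\<close>
lemma nilpotent_add_commuting:
  assumes "x \<in> nilpotents R" "y \<in> nilpotents R" "x \<otimes> y = y \<otimes> x"
  shows "x \<oplus> y \<in> nilpotents R"
proof -
  let ?S = "{x, y}"
  have S: "?S \<subseteq> carrier R" "?S \<subseteq> centralizer ?S"
    using assms unfolding centralizer_def by auto
  have D: "centralizer ?S \<subseteq> carrier R"
    by (rule centralizer_subset)
  have xy: "x \<in> centralizer (centralizer ?S)" "y \<in> centralizer (centralizer ?S)"
    using S in_double_centralizer by auto
  obtain n where n: "x [^] Suc n = \<zero>" using nilpotents_Suc assms(1) .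
  obtain s where s: "s \<in> centralizer (centralizer ?S)" "(x \<oplus> y) [^] Suc n = x [^] Suc n \<oplus> y \<otimes> s"
    using pow_add_commuting[OF D xy assms(3)] by blast
  have "y \<otimes> s \<in> nilpotents R"
    using assms s xy double_centralizer_commute[OF S(2)] by (intro nilpotent_mult_commuting) (auto simp: centralizer_closed)
  moreover have "(x \<oplus> y) [^] Suc n = y \<otimes> s"
    using s n assms centralizer_closed by (simp only: n s(2)) (simp add: centralizer_closed[OF s(1)])
  ultimately have "(x \<oplus> y) [^] Suc n \<in> nilpotents R" by simp
  then obtain m where "((x \<oplus> y) [^] Suc n) [^] Suc m = \<zero>" using nilpotents_Suc by blast
  then have "(x \<oplus> y) [^] (Suc n * Suc m) = \<zero>"
    using assms nat_pow_pow[of "x \<oplus> y" "Suc n" "Suc m"] by simp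
  then show ?thesis by (rule nilpotentsI[rotated]) (simp add: assms(1,2))
qed

text \<open>The powers satisfy \<open>(y x)\<^sup>n\<^sup>+\<^sup>1 = y (x y)\<^sup>n x\<close>.\<close>
lemma nilpotent_swap:
  assumes "x \<in> carrier R" "y \<in> carrier R" "x \<otimes> y \<in> nilpotents R"
  shows "y \<otimes> x \<in> nilpotents R"
proof -
  have *: "(y \<otimes> x) [^] Suc n = y \<otimes> (x \<otimes> y) [^] n \<otimes> x" for n
  proof (induction n)
    case (Suc n)
    have "(y \<otimes> x) [^] Suc (Suc n) = y \<otimes> (x \<otimes> y) [^] n \<otimes> x \<otimes> (y \<otimes> x)"
      using Suc by simp
    then show ?case using assms by (simp add: m_assoc)
  qed (use assms in simp)
  obtain n where "(x \<otimes> y) [^] Suc n = \<zero>" using nilpotents_Suc assms(3) .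
  then have "(y \<otimes> x) [^] Suc (Suc n) = \<zero>"
    using *[of "Suc n"] assms by simp
  then show ?thesis by (rule nilpotentsI[rotated]) (simp add: assms(1,2))
qed

lemma nilpotent_of_square:
  assumes "x \<in> carrier R" "x \<otimes> x \<in> nilpotents R"
  shows "x \<in> nilpotents R"
proof -
  obtain n where "(x \<otimes> x) [^] Suc n = \<zero>" using nilpotents_Suc assms(2) .
  then have "x [^] (2 * Suc n) = \<zero>"
    using nat_pow_pow[of x 2 "Suc n"] assms by (simp add: numeral_2_eq_2)
  then show ?thesis by (rule nilpotentsI[rotated]) (simp add: assms(1,2))
qed

lemma square_zero_nilpotent: "\<lbrakk>x \<in> carrier R; x \<otimes> x = \<zero>\<rbrakk> \<Longrightarrow> x \<in> nilpotents R"
  using nilpotent_of_square[of x] nilpotentsI[of \<zero> 1] by simp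

text \<open>The geometric sum inverts \<open>1 - x\<close>.\<close>
lemma one_minus_nilpotent:
  assumes "x \<in> nilpotents R"
  shows "\<one> \<ominus> x \<in> Units R"
proof -
  let ?S = "{x}"
  have D: "centralizer ?S \<subseteq> carrier R"
    by (rule centralizer_subset)
  have S: "?S \<subseteq> carrier R" "?S \<subseteq> centralizer ?S"
    using assms by (auto simp: centralizer_def)
  have xD: "x \<in> centralizer (centralizer ?S)"
    using S in_double_centralizer by auto
  then have yD: "\<one> \<ominus> x \<in> centralizer (centralizer ?S)"
    using D by (simp add: minus_eq centralizer_add centralizer_one centralizer_uminus)
  obtain n where n: "x [^] Suc n = \<zero>" using nilpotents_Suc assms .
  obtain s where s: "s \<in> centralizer (centralizer ?S)"
      "(x \<oplus> (\<one> \<ominus> x)) [^] Suc n = x [^] Suc n \<oplus> (\<one> \<ominus> x) \<otimes> s"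
    using pow_add_commuting[OF D xD yD] double_centralizer_commute[OF S(2) xD yD] by blast
  have "x \<oplus> (\<one> \<ominus> x) = \<one>" using nilpotents_closed[OF assms] by algebra
  then have "(\<one> \<ominus> x) \<otimes> s = \<one>"
    using s n assms centralizer_closed[OF s(1)] by (simp only: n s(2)) simp
  moreover have "s \<otimes> (\<one> \<ominus> x) = (\<one> \<ominus> x) \<otimes> s"
    using double_centralizer_commute[OF S(2) s(1) yD] .
  ultimately show ?thesis
    using centralizer_closed[OF s(1)] assms unfolding Units_def by auto
qed

lemma one_plus_nilpotent: "x \<in> nilpotents R \<Longrightarrow> \<one> \<oplus> x \<in> Units R"
  using one_minus_nilpotent[of "\<ominus> x"] nilpotent_uminus by (simp add: minus_eq)

lemma nilpotent_idempotent_eq_zero: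
  assumes "e \<in> nilpotents R" "e \<in> idempotents R"
  shows "e = \<zero>"
proof -
  have "e [^] Suc n = e" for n
    using assms by (induction n) (simp_all add: idempotents_idem)
  then show ?thesis using nilpotents_Suc[OF assms(1)] by metis
qed

lemma idempotentsI: "\<lbrakk>e \<in> carrier R; e \<otimes> e = e\<rbrakk> \<Longrightarrow> e \<in> idempotents R"
  unfolding idempotents_def by blast

lemma complement_annihilates:
  assumes "e \<in> idempotents R"
  shows "e \<otimes> (\<one> \<ominus> e) = \<zero>" "(\<one> \<ominus> e) \<otimes> e = \<zero>"
  using assms by (simp_all add: ring_simprules idempotents_idem)

lemma idempotent_complement:
  assumes "e \<in> idempotents R"
  shows "\<one> \<ominus> e \<in> idempotents R"
  using assms by (intro idempotentsI) (simp_all add: ring_simprules idempotents_idem)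

lemma unit_idempotent_eq_one:
  assumes "e \<in> idempotents R" "e \<in> Units R"
  shows "e = \<one>"
proof -
  have "e = inv e \<otimes> (e \<otimes> e)"
    using assms by (simp add: m_assoc[symmetric])
  then show ?thesis using assms by (simp add: idempotents_idem)
qed

text \<open>With \<open>b = 1 - a\<close> and \<open>(a b)\<^sup>k = 0\<close>, write \<open>1 - a\<^sup>k = b s\<close> and \<open>1 - (b s)\<^sup>k = a\<^sup>k q\<close> by geometric
  sums. Then \<open>e = a\<^sup>k q\<close> and \<open>f = b\<^sup>k s\<^sup>k\<close> have sum 1 and product 0, so \<open>e\<close> is idempotent, and
  \<open>a - e = a f - b e\<close> is divisible by the nilpotent \<open>a b\<close>.\<close>
lemma lift_idempotent:
  assumes a: "a \<in> carrier R" and nil: "a \<ominus> a \<otimes> a \<in> nilpotents R"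
  obtains e x where "e \<in> idempotents R" "x \<in> carrier R" "e = a \<otimes> x"
    "a \<otimes> e = e \<otimes> a" "a \<ominus> e \<in> nilpotents R"
proof -
  let ?S = "{a}" and ?b = "\<one> \<ominus> a"
  let ?D = "centralizer (centralizer ?S)"
  have S: "?S \<subseteq> carrier R" "?S \<subseteq> centralizer ?S" and D: "centralizer ?S \<subseteq> carrier R"
    using a unfolding centralizer_def by auto
  note comm = double_centralizer_commute[OF S(2)]
  note closure = centralizer_one[OF D] centralizer_add[OF D] centralizer_uminus[OF D]
    centralizer_mult[OF D] centralizer_pow[OF D]
  have aD: "a \<in> ?D" using S in_double_centralizer by auto
  have bD: "?b \<in> ?D" using aD by (simp add: minus_eq closure)
  have ab: "a \<ominus> a \<otimes> a = a \<otimes> ?b" using a by algebra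
  have nil': "a \<otimes> ?b \<in> nilpotents R" using nil unfolding ab .
  then obtain m where m: "(a \<otimes> ?b) [^] Suc m = \<zero>" using nilpotents_Suc by blast
    \<comment> \<open>A positive exponent, so that the powers of \<open>a\<close> and \<open>b\<close> below contain a factor \<open>a\<close> and \<open>b\<close>.\<close>
define k where "k = Suc m"
  obtain s where sD: "s \<in> ?D" and s: "(a \<oplus> ?b) [^] k = a [^] k \<oplus> ?b \<otimes> s"
    using pow_add_commuting[OF D aD bD comm[OF aD bD]] by blast
  have [simp]: "s \<in> carrier R" using sD by (rule centralizer_closed)
  note [simp] = a
  have "a \<oplus> ?b = \<one>" using a by algebra
  with s have s: "\<one> = a [^] k \<oplus> ?b \<otimes> s" by simp
  have cD: "a [^] k \<in> ?D" and bsD: "?b \<otimes> s \<in> ?D" by (intro closure aD bD sD)+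
  obtain q where qD: "q \<in> ?D" and q: "(?b \<otimes> s \<oplus> a [^] k) [^] k = (?b \<otimes> s) [^] k \<oplus> a [^] k \<otimes> q"
    using pow_add_commuting[OF D bsD cD comm[OF bsD cD]] by blast
  have [simp]: "q \<in> carrier R" using qD by (rule centralizer_closed)
  define e where "e = a [^] k \<otimes> q"
  define f where "f = ?b [^] k \<otimes> s [^] k"
  have eD: "e \<in> ?D" and fD: "f \<in> ?D"
    unfolding e_def f_def by (intro closure aD bD sD qD)+
  have [simp]: "e \<in> carrier R" "f \<in> carrier R" using eD fD centralizer_closed by blast+
  have "f = (?b \<otimes> s) [^] k"
    unfolding f_def using comm[OF bD sD] by (intro pow_mult_distrib[symmetric]) simp_all
  moreover have "?b \<otimes> s \<oplus> a [^] k = \<one>" using s a_comm[of "?b \<otimes> s" "a [^] k"] by simp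
  ultimately have fe: "f \<oplus> e = \<one>" using q e_def by simp
  have bk: "?b [^] k \<in> ?D" and sk: "s [^] k \<in> ?D" by (intro closure bD sD)+
  have "e \<otimes> f = a [^] k \<otimes> (q \<otimes> ?b [^] k) \<otimes> s [^] k"
    unfolding e_def f_def by (simp add: m_assoc)
  also have "\<dots> = (a [^] k \<otimes> ?b [^] k) \<otimes> (q \<otimes> s [^] k)"
    unfolding comm[OF qD bk] by (simp add: m_assoc)
  also have "a [^] k \<otimes> ?b [^] k = (a \<otimes> ?b) [^] k"
    using comm[OF aD bD] by (intro pow_mult_distrib[symmetric]) simp_all
  also have "\<dots> = \<zero>" using m k_def by simp
  finally have ef: "e \<otimes> f = \<zero>" by simp
  have e: "e \<in> idempotents R"
  proof -
    have "e = e \<otimes> (f \<oplus> e)" using fe by simp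
    also have "\<dots> = e \<otimes> e" using ef by (simp add: r_distr)
    finally show ?thesis by (intro idempotentsI) simp_all
  qed
  have am: "a [^] m \<in> ?D" and bm: "?b [^] m \<in> ?D" by (intro closure aD bD)+
  define t where "t = ?b [^] m \<otimes> s [^] k \<ominus> a [^] m \<otimes> q"
  have tD: "t \<in> ?D"
    unfolding t_def minus_eq[of "?b [^] m \<otimes> s [^] k"] by (intro closure am bm sk qD)
  have ak: "a [^] k = a \<otimes> a [^] m" and bk': "?b [^] k = ?b \<otimes> ?b [^] m"
    unfolding k_def by (simp_all only: nat_pow_Suc2 a minus_closed one_closed)
  have "a \<ominus> e = a \<otimes> (f \<oplus> e) \<ominus> e" using fe by simp
  also have "\<dots> = a \<otimes> f \<ominus> ?b \<otimes> e"
    using \<open>e \<in> carrier R\<close> \<open>f \<in> carrier R\<close> a by algebra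
  also have "\<dots> = a \<otimes> ?b \<otimes> (?b [^] m \<otimes> s [^] k) \<ominus> ?b \<otimes> a \<otimes> (a [^] m \<otimes> q)"
    unfolding e_def f_def ak bk' by (simp add: m_assoc)
  also have "\<dots> = a \<otimes> ?b \<otimes> t"
    unfolding comm[OF bD aD] t_def by (simp add: r_distr r_minus minus_eq)
  finally have ae: "a \<ominus> e = a \<otimes> ?b \<otimes> t" .
  have "a \<otimes> ?b \<in> ?D" by (intro closure aD bD)
  then have "a \<ominus> e \<in> nilpotents R"
    unfolding ae by (rule nilpotent_mult_commuting[OF nil' centralizer_closed[OF tD] comm[OF _ tD]])
  moreover have e_mult: "e = a \<otimes> (a [^] m \<otimes> q)" unfolding e_def ak by (simp add: m_assoc)
  ultimately show thesis
    by (intro that[OF e _ e_mult comm[OF aD eD]]) simp_all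
qed

section \<open>Peirce decompositions\<close>

lemma peirce_square_zero:
  assumes "e \<in> idempotents R" "r \<in> carrier R"
  shows "e \<otimes> r \<otimes> (\<one> \<ominus> e) \<otimes> (e \<otimes> r \<otimes> (\<one> \<ominus> e)) = \<zero>"
    and "(\<one> \<ominus> e) \<otimes> r \<otimes> e \<otimes> ((\<one> \<ominus> e) \<otimes> r \<otimes> e) = \<zero>"
proof -
  have [simp]: "e \<in> carrier R" "r \<in> carrier R" using assms by simp_all
  have "e \<otimes> r \<otimes> (\<one> \<ominus> e) \<otimes> (e \<otimes> r \<otimes> (\<one> \<ominus> e)) = e \<otimes> r \<otimes> ((\<one> \<ominus> e) \<otimes> e) \<otimes> (r \<otimes> (\<one> \<ominus> e))"
    by (simp add: m_assoc)
  then show "e \<otimes> r \<otimes> (\<one> \<ominus> e) \<otimes> (e \<otimes> r \<otimes> (\<one> \<ominus> e)) = \<zero>"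
    by (simp add: complement_annihilates[OF assms(1)])
  have "(\<one> \<ominus> e) \<otimes> r \<otimes> e \<otimes> ((\<one> \<ominus> e) \<otimes> r \<otimes> e) = (\<one> \<ominus> e) \<otimes> r \<otimes> (e \<otimes> (\<one> \<ominus> e)) \<otimes> (r \<otimes> e)"
    by (simp add: m_assoc)
  then show "(\<one> \<ominus> e) \<otimes> r \<otimes> e \<otimes> ((\<one> \<ominus> e) \<otimes> r \<otimes> e) = \<zero>"
    by (simp add: complement_annihilates[OF assms(1)])
qed

text \<open>If \<open>e = n x\<close> is idempotent, the off-diagonal Peirce parts of \<open>n\<close> and \<open>x\<close> multiply to \<open>e\<close>, up to
  a term with the factor \<open>n\<^sup>2\<close>. So \<open>e\<close> is a product of two elements of square zero as soon as
  \<open>n\<^sup>2\<close> may be neglected.\<close>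
lemma peirce_corner_product:
  assumes n: "n \<in> carrier R" and x: "x \<in> carrier R" and e: "n \<otimes> x \<in> idempotents R"
  defines "e \<equiv> n \<otimes> x"
  shows "(e \<otimes> n \<otimes> (\<one> \<ominus> e)) \<otimes> ((\<one> \<ominus> e) \<otimes> x \<otimes> e) = e \<ominus> e \<otimes> ((n \<otimes> n) \<otimes> (x \<otimes> x \<otimes> e))"
proof -
  have eI: "e \<in> idempotents R" and ec [simp]: "e \<in> carrier R" and ee: "e \<otimes> e = e"
    using e n x e_def idempotents_idem by simp_all
  note [simp] = n x
  have "(e \<otimes> n \<otimes> (\<one> \<ominus> e)) \<otimes> ((\<one> \<ominus> e) \<otimes> x \<otimes> e) = e \<otimes> n \<otimes> ((\<one> \<ominus> e) \<otimes> (\<one> \<ominus> e)) \<otimes> (x \<otimes> e)"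
    by (simp add: m_assoc)
  also have "\<dots> = e \<otimes> n \<otimes> (\<one> \<ominus> e) \<otimes> (x \<otimes> e)"
    using idempotents_idem[OF idempotent_complement[OF eI]] by simp
  also have "\<dots> = e \<otimes> (n \<otimes> x) \<otimes> e \<ominus> e \<otimes> (n \<otimes> e \<otimes> (x \<otimes> e))"
    using n x ec by algebra
  also have "e \<otimes> (n \<otimes> x) \<otimes> e = e"
    unfolding e_def[symmetric] by (simp add: ee)
  also have "n \<otimes> e \<otimes> (x \<otimes> e) = (n \<otimes> n) \<otimes> (x \<otimes> x \<otimes> e)"
    by (subst e_def) (simp add: m_assoc)
  finally show ?thesis .
qed

section \<open>Elements that generate nil right ideals\<close>

text \<open>In a weakly exchange ring whose units differ from 1 or \<open>- 1\<close> by nilpotents, this set is an ideal,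
  namely both the Jacobson radical and the upper nilradical.\<close>
definition nilradical :: "'a set"
  where "nilradical = {b \<in> carrier R. \<forall>r \<in> carrier R. b \<otimes> r \<in> nilpotents R}"

lemma nilradical_closed [simp]: "b \<in> nilradical \<Longrightarrow> b \<in> carrier R"
  unfolding nilradical_def by blast

lemma nilradicalD: "b \<in> nilradical \<Longrightarrow> r \<in> carrier R \<Longrightarrow> b \<otimes> r \<in> nilpotents R"
  unfolding nilradical_def by blast

lemma nilradicalI:
  "\<lbrakk>b \<in> carrier R; \<And>r. r \<in> carrier R \<Longrightarrow> b \<otimes> r \<in> nilpotents R\<rbrakk> \<Longrightarrow> b \<in> nilradical"
  unfolding nilradical_def by blast

lemma nilradical_nilpotent: "b \<in> nilradical \<Longrightarrow> b \<in> nilpotents R"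
  using nilradicalD[of b \<one>] by simp

lemma nilradical_mult_right: "\<lbrakk>b \<in> nilradical; r \<in> carrier R\<rbrakk> \<Longrightarrow> b \<otimes> r \<in> nilradical"
  by (rule nilradicalI) (simp_all add: m_assoc nilradicalD)

text \<open>Nilpotency of \<open>r b s\<close> is that of \<open>b s r\<close>, where \<open>b\<close> is in front again.\<close>
lemma nilradical_mult_left:
  assumes "b \<in> nilradical" "r \<in> carrier R"
  shows "r \<otimes> b \<in> nilradical"
proof (rule nilradicalI)
  fix s assume s: "s \<in> carrier R"
  have "b \<otimes> s \<otimes> r \<in> nilpotents R"
    using nilradicalD[OF assms(1), of "s \<otimes> r"] s assms by (simp add: m_assoc)
  then have "r \<otimes> (b \<otimes> s) \<in> nilpotents R"
    using nilpotent_swap[of "b \<otimes> s" r] s assms by simp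
  then show "r \<otimes> b \<otimes> s \<in> nilpotents R"
    using s assms by (simp add: m_assoc)
qed (use assms in simp)

lemma nilradical_uminus: "b \<in> nilradical \<Longrightarrow> \<ominus> b \<in> nilradical"
  using nilradical_mult_right[of b "\<ominus> \<one>"] by (simp add: r_minus)

section \<open>The integer six\<close>

abbreviation two :: 'a ("\<two>") where "\<two> \<equiv> \<one> \<oplus> \<one>"
abbreviation three :: 'a ("\<three>") where "\<three> \<equiv> \<one> \<oplus> \<one> \<oplus> \<one>"
abbreviation six :: 'a ("\<six>") where "\<six> \<equiv> \<two> \<otimes> \<three>"

lemma six_commute: "x \<in> carrier R \<Longrightarrow> \<six> \<otimes> x = x \<otimes> \<six>"
  by algebra

lemma central_mult_mult:
  assumes "c \<in> carrier R" "x \<in> carrier R" "y \<in> carrier R" "c \<otimes> x = x \<otimes> c"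
  shows "(c \<otimes> x) \<otimes> (c \<otimes> y) = c \<otimes> c \<otimes> (x \<otimes> y)"
proof -
  have "(c \<otimes> x) \<otimes> (c \<otimes> y) = c \<otimes> (x \<otimes> c) \<otimes> y"
    using assms(1-3) by (simp add: m_assoc)
  also have "\<dots> = c \<otimes> c \<otimes> (x \<otimes> y)"
    unfolding assms(4)[symmetric] using assms(1-3) by (simp add: m_assoc)
  finally show ?thesis .
qed

text \<open>The element \<open>1 - 2 e\<close> is its own inverse.\<close>
lemma one_minus_two_idempotent_unit:
  assumes "e \<in> idempotents R"
  shows "\<one> \<ominus> \<two> \<otimes> e \<in> Units R"
proof -
  have e: "e \<in> carrier R" "e \<otimes> e = e" using assms idempotents_idem by simp_all
  have "(\<one> \<ominus> \<two> \<otimes> e) \<otimes> (\<one> \<ominus> \<two> \<otimes> e) = \<one> \<ominus> (e \<oplus> e \<oplus> e \<oplus> e) \<oplus> (e \<otimes> e \<oplus> e \<otimes> e \<oplus> e \<otimes> e \<oplus> e \<otimes> e)"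
    using e(1) by algebra
  also have "\<dots> = \<one>"
    unfolding e(2) using e(1) by algebra
  finally show ?thesis
    using e(1) unfolding Units_def by auto
qed

text \<open>The equation \<open>f = m y\<close> makes \<open>m f\<close> invertible in the corner ring \<open>f R f\<close>; an element that is
  both invertible and nilpotent there forces \<open>f = 0\<close>.\<close>
lemma idempotent_zero_of_multiple:
  assumes f: "f \<in> idempotents R" and y: "y \<in> carrier R" and m: "m \<in> carrier R"
    and f_eq: "f = m \<otimes> y" and comm: "\<And>r. r \<in> carrier R \<Longrightarrow> m \<otimes> r = r \<otimes> m"
    and nil: "m \<otimes> f \<in> nilpotents R"
  shows "f = \<zero>"
proof -
  have [simp]: "f \<in> carrier R" using f by simp
  note [simp] = y m
  have ff: "f \<otimes> f = f" by (rule idempotents_idem[OF f])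
  have mf: "m \<otimes> f = f \<otimes> m" by (rule comm) simp
  have *: "(m \<otimes> f) \<otimes> (f \<otimes> y \<otimes> f) = f" "(f \<otimes> y \<otimes> f) \<otimes> (m \<otimes> f) = f"
  proof -
    have "(m \<otimes> f) \<otimes> (f \<otimes> y \<otimes> f) = (f \<otimes> m) \<otimes> (f \<otimes> y \<otimes> f)" unfolding mf ..
    also have "\<dots> = f \<otimes> (m \<otimes> f) \<otimes> (y \<otimes> f)" by (simp add: m_assoc)
    also have "\<dots> = (f \<otimes> f) \<otimes> (m \<otimes> y) \<otimes> f" unfolding mf by (simp add: m_assoc)
    also have "\<dots> = f" unfolding f_eq[symmetric] by (simp add: ff)
    finally show "(m \<otimes> f) \<otimes> (f \<otimes> y \<otimes> f) = f" .
    have "(f \<otimes> y \<otimes> f) \<otimes> (m \<otimes> f) = f \<otimes> y \<otimes> (f \<otimes> m) \<otimes> f" by (simp add: m_assoc)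
    also have "\<dots> = f \<otimes> (y \<otimes> m) \<otimes> (f \<otimes> f)" unfolding mf[symmetric] by (simp add: m_assoc)
    also have "y \<otimes> m = m \<otimes> y" using comm[of y] by simp
    also have "f \<otimes> (m \<otimes> y) \<otimes> (f \<otimes> f) = f" unfolding f_eq[symmetric] by (simp add: ff)
    finally show "(f \<otimes> y \<otimes> f) \<otimes> (m \<otimes> f) = f" .
  qed
  have "(m \<otimes> f) \<otimes> (f \<otimes> y \<otimes> f) \<in> nilpotents R"
    by (rule nilpotent_mult_commuting[OF nil]) (simp_all only: * m_closed \<open>f \<in> carrier R\<close> y)
  then show ?thesis using * nilpotent_idempotent_eq_zero[OF _ f] by simp
qed

end

text \<open>The standing hypotheses of the harder implication.\<close>
locale weakly_exchange_WUU_ring = ring R for R (structure) +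
  assumes weakly_exchange: "weakly_exchange R" and WUU: "WUU R"
begin

lemma exchange:
  assumes "a \<in> carrier R"
  obtains e x y where "e \<in> idempotents R" "x \<in> carrier R" "y \<in> carrier R" "e = a \<otimes> x"
    "\<one> \<ominus> e = (\<one> \<ominus> a) \<otimes> y \<or> \<one> \<ominus> e = (\<one> \<oplus> a) \<otimes> y"
  using weakly_exchange assms unfolding weakly_exchange_def l_coset_def by blast

lemma unit_cases:
  assumes "u \<in> Units R"
  shows "u \<ominus> \<one> \<in> nilpotents R \<or> u \<oplus> \<one> \<in> nilpotents R"
proof -
  consider n where "n \<in> nilpotents R" "u = \<one> \<oplus> n" | n where "n \<in> nilpotents R" "u = \<ominus> \<one> \<oplus> n"
    using WUU assms unfolding WUU_def a_l_coset_def' by blast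
  then show ?thesis
  proof cases
    case 1
    then have "u \<ominus> \<one> = n" using nilpotents_closed[OF 1(1)] by algebra
    with 1 show ?thesis by simp
  next
    case 2
    then have "u \<oplus> \<one> = n" using nilpotents_closed[OF 2(1)] by algebra
    with 2 show ?thesis by simp
  qed
qed

text \<open>This is the condition on units for \<open>1 - 2 e\<close>.\<close>
lemma idempotent_cases:
  assumes "e \<in> idempotents R"
  shows "\<two> \<otimes> e \<in> nilpotents R \<or> \<two> \<otimes> (\<one> \<ominus> e) \<in> nilpotents R"
proof -
  have e: "e \<in> carrier R" using assms by simp
  have "\<ominus> (\<one> \<ominus> \<two> \<otimes> e \<ominus> \<one>) = \<two> \<otimes> e" "\<one> \<ominus> \<two> \<otimes> e \<oplus> \<one> = \<two> \<otimes> (\<one> \<ominus> e)"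
    using e by algebra+
  then show ?thesis
    using unit_cases[OF one_minus_two_idempotent_unit[OF assms]] nilpotent_uminus by metis
qed

text \<open>Exchange for 3 gives an idempotent \<open>e\<close> divisible by 3 whose complement \<open>f\<close> is divisible by 2.
  If \<open>2 f\<close> is nilpotent, then \<open>f = 0\<close>, so 3 is a unit and one of 2 and 4 is nilpotent. Otherwise
  \<open>2 e\<close> is nilpotent; moreover \<open>1 + f\<close>, which is \<open>e + 2 f\<close>, is a unit because 2 is invertible on
  \<open>f\<close>. So \<open>f\<close> or \<open>2 + f\<close> is nilpotent, that is, \<open>f = 0\<close> or \<open>3 f\<close> is nilpotent. Either way
  \<open>6 = 6 e + 6 f\<close> is nilpotent.\<close>
lemma six_nilpotent: "\<six> \<in> nilpotents R"
proof -
  obtain e x y where e: "e \<in> idempotents R" and x: "x \<in> carrier R" and y: "y \<in> carrier R"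
    and ex: "e = \<three> \<otimes> x" and ey: "\<one> \<ominus> e = (\<one> \<ominus> \<three>) \<otimes> y \<or> \<one> \<ominus> e = (\<one> \<oplus> \<three>) \<otimes> y"
    by (rule exchange[of "\<three>"]) simp_all
  define f where "f = \<one> \<ominus> e"
  have f: "f \<in> idempotents R" unfolding f_def by (rule idempotent_complement[OF e])
  have ec [simp]: "e \<in> carrier R" and fc [simp]: "f \<in> carrier R" using e f by simp_all
  note [simp] = x
  have ff: "f \<otimes> f = f" and ee: "e \<otimes> e = e" using e f idempotents_idem by blast+
  have ef: "e \<otimes> f = \<zero>" "f \<otimes> e = \<zero>" unfolding f_def by (rule complement_annihilates[OF e])+
  have two: "\<two> \<otimes> r = r \<otimes> \<two>" if "r \<in> carrier R" for r using that by algebra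
  have three: "\<three> \<otimes> r = r \<otimes> \<three>" if "r \<in> carrier R" for r using that by algebra
  obtain z where z [simp]: "z \<in> carrier R" and fz: "f = \<two> \<otimes> z"
  proof -
    have "(\<one> \<ominus> \<three>) \<otimes> y = \<two> \<otimes> (\<ominus> y)" "(\<one> \<oplus> \<three>) \<otimes> y = \<two> \<otimes> (y \<oplus> y)"
      using y by algebra+
    then show thesis using that[of "\<ominus> y"] that[of "y \<oplus> y"] ey y unfolding f_def by auto
  qed
  have e_plus_f: "e \<oplus> f = \<one>" unfolding f_def using ec by algebra
  have six_if_two: "\<six> \<in> nilpotents R" if "\<two> \<in> nilpotents R"
    by (rule nilpotent_mult_commuting[OF that _ two]) simp_all
  have e_one: "e = \<one>" if "f = \<zero>"
  proof -
    have "e = \<one> \<ominus> f" unfolding f_def using ec by algebra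
    then show ?thesis using that by (simp add: minus_eq)
  qed
  from idempotent_cases[OF f] show ?thesis
  proof
    assume nil: "\<two> \<otimes> f \<in> nilpotents R"
    have "f = \<zero>"
      by (rule idempotent_zero_of_multiple[OF f z _ fz two nil]) simp_all
    then have "\<three> \<otimes> x = \<one>" using e_one ex by simp
    then have "\<three> \<in> Units R" using three[of x] x unfolding Units_def by auto
    then have "\<three> \<ominus> \<one> \<in> nilpotents R \<or> \<three> \<oplus> \<one> \<in> nilpotents R"
      by (rule unit_cases)
    moreover have "\<three> \<ominus> \<one> = \<two>"
      by (simp add: a_minus_def a_assoc r_neg)
    moreover have "\<three> \<oplus> \<one> = \<two> \<otimes> \<two>"
      by (simp add: l_distr a_assoc)
    ultimately have "\<two> \<in> nilpotents R \<or> \<two> \<otimes> \<two> \<in> nilpotents R" by (simp only:)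
    then have "\<two> \<in> nilpotents R" using nilpotent_of_square[OF a_closed[OF one_closed one_closed]] by blast
    then show ?thesis by (rule six_if_two)
  next
    assume "\<two> \<otimes> (\<one> \<ominus> f) \<in> nilpotents R"
    moreover have "\<one> \<ominus> f = e" unfolding f_def using ec by algebra
    ultimately have nil: "\<two> \<otimes> e \<in> nilpotents R" by simp
        \<comment> \<open>As \<open>f = 2 z\<close>, the element \<open>f z f\<close> inverts 2 in the corner ring of \<open>f\<close>.\<close>
have fzf: "f \<otimes> (\<two> \<otimes> z) \<otimes> f = f" unfolding fz[symmetric] by (simp add: ff)
    have "(\<one> \<oplus> f) \<otimes> (e \<oplus> f \<otimes> z \<otimes> f) = e \<oplus> f \<otimes> e \<oplus> (f \<otimes> z \<otimes> f \<oplus> (f \<otimes> f) \<otimes> z \<otimes> f)"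
      using ec fc z by algebra
    also have "\<dots> = e \<oplus> f \<otimes> (\<two> \<otimes> z) \<otimes> f"
      unfolding ef ff using ec fc z by algebra
    also have "\<dots> = \<one>"
      unfolding fzf by (rule e_plus_f)
    finally have r: "(\<one> \<oplus> f) \<otimes> (e \<oplus> f \<otimes> z \<otimes> f) = \<one>" .
    have "(e \<oplus> f \<otimes> z \<otimes> f) \<otimes> (\<one> \<oplus> f) = e \<oplus> e \<otimes> f \<oplus> (f \<otimes> z \<otimes> f \<oplus> f \<otimes> z \<otimes> (f \<otimes> f))"
      using ec fc z by algebra
    also have "\<dots> = e \<oplus> f \<otimes> (\<two> \<otimes> z) \<otimes> f"
      unfolding ef ff using ec fc z by algebra
    also have "\<dots> = \<one>"
      unfolding fzf by (rule e_plus_f)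
    finally have "\<one> \<oplus> f \<in> Units R" using r unfolding Units_def by auto
    then have "\<one> \<oplus> f \<ominus> \<one> \<in> nilpotents R \<or> \<one> \<oplus> f \<oplus> \<one> \<in> nilpotents R"
      by (rule unit_cases)
    then show ?thesis
    proof
      assume "\<one> \<oplus> f \<ominus> \<one> \<in> nilpotents R"
      moreover have "\<one> \<oplus> f \<ominus> \<one> = f" using fc by algebra
      ultimately have "f = \<zero>" using nilpotent_idempotent_eq_zero f by simp
      then have "\<two> \<in> nilpotents R" using nil e_one by simp
      then show ?thesis by (rule six_if_two)
    next
      assume "\<one> \<oplus> f \<oplus> \<one> \<in> nilpotents R"
      then have "(\<one> \<oplus> f \<oplus> \<one>) \<otimes> f \<in> nilpotents R"
        by (rule nilpotent_mult_commuting) (use fc in algebra)+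
      moreover have "(\<one> \<oplus> f \<oplus> \<one>) \<otimes> f = f \<oplus> f \<otimes> f \<oplus> f" using fc by algebra
      ultimately have nil3: "\<three> \<otimes> f \<in> nilpotents R"
        unfolding ff by (simp add: l_distr)
      have "\<three> \<otimes> f \<otimes> \<two> \<in> nilpotents R"
        by (rule nilpotent_mult_commuting[OF nil3 _ two[symmetric]]) simp_all
      moreover have "\<three> \<otimes> f \<otimes> \<two> = \<six> \<otimes> f" using fc by algebra
      moreover have "\<two> \<otimes> e \<otimes> \<three> \<in> nilpotents R"
        by (rule nilpotent_mult_commuting[OF nil _ three[symmetric]]) simp_all
      moreover have "\<two> \<otimes> e \<otimes> \<three> = \<six> \<otimes> e" using ec by algebra
      moreover have "(\<six> \<otimes> f) \<otimes> (\<six> \<otimes> e) = (\<six> \<otimes> e) \<otimes> (\<six> \<otimes> f)"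
        using central_mult_mult[OF _ fc ec six_commute[OF fc]] central_mult_mult[OF _ ec fc six_commute[OF ec]]
        by (simp add: ef)
      ultimately have "\<six> \<otimes> f \<oplus> \<six> \<otimes> e \<in> nilpotents R"
        using nilpotent_add_commuting[of "\<six> \<otimes> f" "\<six> \<otimes> e"] by simp
      moreover have "\<six> \<otimes> f \<oplus> \<six> \<otimes> e = \<six> \<otimes> (e \<oplus> f)"
        using r_distr[OF ec fc, of "\<six>"] a_comm[of "\<six> \<otimes> f" "\<six> \<otimes> e"] by simp
      ultimately show ?thesis unfolding e_plus_f by simp
    qed
  qed
qed

section \<open>Right ideals without idempotents\<close>

text \<open>The hypotheses say that \<open>p\<close> and \<open>q\<close> are the off-diagonal matrix units over the corner with
  identity \<open>g = p q + q p\<close>. The product of the units \<open>1 + p\<close> and \<open>1 + q\<close> is \<open>1 + z\<close> where \<open>z\<close> has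
  the rows (1, 1) and (1, 0), so \<open>z\<^sup>2 = z + g\<close> by the Cayley-Hamilton theorem. If \<open>z\<close> is nilpotent,
  so is \<open>z (z - 1) = g\<close>. If \<open>z + 2\<close> is nilpotent, so is \<open>(z + 2) (z - 3) = g - 6\<close>, and
  6 is nilpotent. Both times the idempotent \<open>g\<close> vanishes.\<close>
lemma matrix_units_vanish:
  assumes p [simp]: "p \<in> carrier R" and q [simp]: "q \<in> carrier R"
    and pp: "p \<otimes> p = \<zero>" and qq: "q \<otimes> q = \<zero>"
    and pqp: "p \<otimes> q \<otimes> p = p" and qpq: "q \<otimes> p \<otimes> q = q"
  shows "p \<otimes> q = \<zero>"
proof -
  define z where "z = p \<oplus> q \<oplus> p \<otimes> q"
  define g where "g = p \<otimes> q \<oplus> q \<otimes> p"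
  have z [simp]: "z \<in> carrier R" and g [simp]: "g \<in> carrier R" unfolding z_def g_def by simp_all
  have "z \<otimes> z = p \<otimes> p \<oplus> p \<otimes> q \<oplus> p \<otimes> p \<otimes> q \<oplus> (q \<otimes> p \<oplus> q \<otimes> q \<oplus> q \<otimes> p \<otimes> q)
      \<oplus> (p \<otimes> q \<otimes> p \<oplus> p \<otimes> (q \<otimes> q) \<oplus> p \<otimes> q \<otimes> p \<otimes> q)"
    unfolding z_def using p q by algebra
  also have "\<dots> = z \<oplus> g"
    unfolding pp qq pqp qpq z_def g_def using p q by algebra
  finally have zz: "z \<otimes> z = z \<oplus> g" .
  have "g \<otimes> g = p \<otimes> q \<otimes> p \<otimes> q \<oplus> p \<otimes> (q \<otimes> q) \<otimes> p \<oplus> (q \<otimes> (p \<otimes> p) \<otimes> q \<oplus> q \<otimes> p \<otimes> q \<otimes> p)"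
    unfolding g_def using p q by algebra
  also have "\<dots> = g"
    unfolding pp qq pqp qpq g_def using p q by algebra
  finally have gI: "g \<in> idempotents R" by (intro idempotentsI) simp_all
  have "\<one> \<oplus> z = (\<one> \<oplus> p) \<otimes> (\<one> \<oplus> q)"
    unfolding z_def using p q by algebra
  then have "\<one> \<oplus> z \<in> Units R"
    using one_plus_nilpotent square_zero_nilpotent pp qq by simp
  then have "\<one> \<oplus> z \<ominus> \<one> \<in> nilpotents R \<or> \<one> \<oplus> z \<oplus> \<one> \<in> nilpotents R"
    by (rule unit_cases)
  then have "g \<in> nilpotents R"
  proof
    assume "\<one> \<oplus> z \<ominus> \<one> \<in> nilpotents R"
    moreover have "\<one> \<oplus> z \<ominus> \<one> = z" using z by algebra
    ultimately have zn: "z \<in> nilpotents R" by simp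
    have "z \<otimes> (z \<ominus> \<one>) \<in> nilpotents R"
    proof (rule nilpotent_mult_commuting[OF zn])
      show "z \<otimes> (z \<ominus> \<one>) = (z \<ominus> \<one>) \<otimes> z" using z by algebra
    qed simp
    moreover have "z \<otimes> (z \<ominus> \<one>) = z \<otimes> z \<ominus> z" using z by algebra
    moreover have "z \<otimes> z \<ominus> z = g" unfolding zz using z g by algebra
    ultimately show ?thesis by simp
  next
    assume "\<one> \<oplus> z \<oplus> \<one> \<in> nilpotents R"
    moreover have "\<one> \<oplus> z \<oplus> \<one> = z \<oplus> \<two>" using z by algebra
    ultimately have zn: "z \<oplus> \<two> \<in> nilpotents R" by simp
    have "(z \<oplus> \<two>) \<otimes> (z \<ominus> \<three>) \<in> nilpotents R"
    proof (rule nilpotent_mult_commuting[OF zn])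
      show "(z \<oplus> \<two>) \<otimes> (z \<ominus> \<three>) = (z \<ominus> \<three>) \<otimes> (z \<oplus> \<two>)" using z by algebra
    qed simp
    moreover have "(z \<oplus> \<two>) \<otimes> (z \<ominus> \<three>) = z \<otimes> z \<ominus> z \<ominus> \<six>" using z by algebra
    moreover have "z \<otimes> z \<ominus> z \<ominus> \<six> = g \<ominus> \<six>" unfolding zz using z g by algebra
    ultimately have "g \<ominus> \<six> \<in> nilpotents R" by simp
    then have "(g \<ominus> \<six>) \<oplus> \<six> \<in> nilpotents R"
      by (rule nilpotent_add_commuting[OF _ six_nilpotent six_commute[symmetric]]) simp
    moreover have "(g \<ominus> \<six>) \<oplus> \<six> = g" using g by algebra
    ultimately show ?thesis by simp
  qed
  then have g0: "g = \<zero>" using nilpotent_idempotent_eq_zero gI by blast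
  have "p \<otimes> q \<otimes> g = p \<otimes> q \<otimes> p \<otimes> q \<oplus> p \<otimes> (q \<otimes> q) \<otimes> p"
    unfolding g_def using p q by algebra
  also have "\<dots> = p \<otimes> q" unfolding pqp qq by simp
  finally show ?thesis using g0 by simp
qed

text \<open>For an idempotent \<open>e = b x\<close> the off-diagonal Peirce parts of \<open>b\<close> and \<open>x\<close> are matrix units with
  product \<open>e\<close>.\<close>
lemma square_zero_no_idempotent:
  assumes b: "b \<in> carrier R" and bb: "b \<otimes> b = \<zero>" and x: "x \<in> carrier R"
    and e: "b \<otimes> x \<in> idempotents R"
  shows "b \<otimes> x = \<zero>"
proof -
  define e where "e = b \<otimes> x"
  define p where "p = e \<otimes> b \<otimes> (\<one> \<ominus> e)"
  define q where "q = (\<one> \<ominus> e) \<otimes> x \<otimes> e"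
  have eI: "e \<in> idempotents R" and ec [simp]: "e \<in> carrier R" and ee: "e \<otimes> e = e"
    using e e_def idempotents_idem b x by simp_all
  note [simp] = b x
  have pc [simp]: "p \<in> carrier R" and qc [simp]: "q \<in> carrier R" unfolding p_def q_def by simp_all
  have pq: "p \<otimes> q = e"
    using peirce_corner_product[OF b x e] unfolding p_def q_def e_def[symmetric] by (simp add: bb minus_eq)
  have "e \<otimes> p = p" unfolding p_def by (simp add: m_assoc[symmetric] ee)
  moreover have "q \<otimes> e = q" unfolding q_def by (simp add: m_assoc ee)
  ultimately have "p \<otimes> q \<otimes> p = p" "q \<otimes> p \<otimes> q = q"
    using m_assoc[OF qc pc qc] by (simp_all add: pq)
  moreover have "p \<otimes> p = \<zero>" "q \<otimes> q = \<zero>"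
    unfolding p_def q_def by (rule peirce_square_zero[OF eI]; simp)+
  ultimately show ?thesis using matrix_units_vanish[OF pc qc] pq e_def by simp
qed

text \<open>If \<open>c d = 1\<close>, the idempotent \<open>h = 1 - d c\<close> satisfies \<open>c h = 0\<close>. Hence \<open>h c\<close> has square zero
  while \<open>h c d = h\<close> lies in the right ideal that it generates.\<close>
lemma left_inverse_if_right_inverse:
  assumes c [simp]: "c \<in> carrier R" and d [simp]: "d \<in> carrier R" and cd: "c \<otimes> d = \<one>"
  shows "d \<otimes> c = \<one>"
proof -
  define h where "h = \<one> \<ominus> d \<otimes> c"
  have h [simp]: "h \<in> carrier R" unfolding h_def by simp
  have "d \<otimes> c \<in> idempotents R"
  proof (rule idempotentsI)
    have "d \<otimes> c \<otimes> (d \<otimes> c) = d \<otimes> (c \<otimes> d) \<otimes> c" by (simp add: m_assoc)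
    then show "d \<otimes> c \<otimes> (d \<otimes> c) = d \<otimes> c" by (simp add: cd)
  qed simp
  then have hI: "h \<in> idempotents R" unfolding h_def by (rule idempotent_complement)
  have "c \<otimes> h = c \<ominus> c \<otimes> d \<otimes> c" unfolding h_def using c d by algebra
  then have ch: "c \<otimes> h = \<zero>" by (simp add: cd minus_eq r_neg)
  have "h \<otimes> c \<otimes> (h \<otimes> c) = h \<otimes> (c \<otimes> h) \<otimes> c" by (simp add: m_assoc)
  then have sq: "h \<otimes> c \<otimes> (h \<otimes> c) = \<zero>" by (simp add: ch)
  have hcd: "h \<otimes> c \<otimes> d = h" by (simp add: m_assoc cd)
  have "h = \<zero>"
    using square_zero_no_idempotent[OF _ sq d] hI by (simp add: hcd)
  moreover have "d \<otimes> c = \<one> \<ominus> h" unfolding h_def using c d by algebra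
  ultimately show ?thesis by (simp add: minus_eq)
qed

text \<open>Modulo nilpotents \<open>t = 2\<close> and \<open>6 = 0\<close>, so \<open>t + t\<^sup>2 = 6\<close> vanishes and \<open>- t\<close> lifts to an
  idempotent in \<open>tR\<close>. The hypothesis leaves only the idempotent 0.\<close>
lemma nilpotent_if_near_two:
  assumes t [simp]: "t \<in> carrier R" and near: "\<two> \<ominus> t \<in> nilpotents R"
    and none: "\<And>x. x \<in> carrier R \<Longrightarrow> t \<otimes> x \<in> idempotents R \<Longrightarrow> t \<otimes> x = \<zero>"
  shows "t \<in> nilpotents R"
proof -
  define n where "n = \<two> \<ominus> t"
  have n [simp]: "n \<in> carrier R" unfolding n_def by simp
  have t_eq: "t = \<two> \<ominus> n" unfolding n_def using t by algebra
  have "n \<otimes> (n \<ominus> (\<two> \<oplus> \<three>)) \<in> nilpotents R"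
  proof (rule nilpotent_mult_commuting)
    show "n \<otimes> (n \<ominus> (\<two> \<oplus> \<three>)) = (n \<ominus> (\<two> \<oplus> \<three>)) \<otimes> n" using n by algebra
  qed (use near n_def in simp_all)
  then have "\<six> \<oplus> n \<otimes> (n \<ominus> (\<two> \<oplus> \<three>)) \<in> nilpotents R"
    by (rule nilpotent_add_commuting[OF six_nilpotent _ six_commute]) simp
  then have "\<ominus> (\<six> \<oplus> n \<otimes> (n \<ominus> (\<two> \<oplus> \<three>))) \<in> nilpotents R"
    by (rule nilpotent_uminus)
  moreover have "\<ominus> (\<six> \<oplus> n \<otimes> (n \<ominus> (\<two> \<oplus> \<three>))) = \<ominus> t \<ominus> \<ominus> t \<otimes> \<ominus> t"
  proof -
        \<comment> \<open>Applied to 2 and 3: \<open>t + t\<^sup>2 = t (t + 1) = (2 - n) (3 - n)\<close>.\<close>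
have *: "(c \<ominus> n) \<otimes> (d \<ominus> n) = c \<otimes> d \<oplus> n \<otimes> (n \<ominus> (c \<oplus> d))"
      if c: "c \<in> carrier R" and d: "d \<in> carrier R" and cn: "c \<otimes> n = n \<otimes> c" for c d
    proof -
      have "(c \<ominus> n) \<otimes> (d \<ominus> n) = c \<otimes> d \<ominus> c \<otimes> n \<ominus> n \<otimes> d \<oplus> n \<otimes> n"
        using c d n by algebra
      also have "\<dots> = c \<otimes> d \<oplus> n \<otimes> (n \<ominus> (c \<oplus> d))"
        unfolding cn using c d n by algebra
      finally show ?thesis .
    qed
    have "\<two> \<otimes> n = n \<otimes> \<two>" using n by algebra
    then have "\<six> \<oplus> n \<otimes> (n \<ominus> (\<two> \<oplus> \<three>)) = (\<two> \<ominus> n) \<otimes> (\<three> \<ominus> n)"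
      using *[of "\<two>" "\<three>"] by simp
    also have "\<three> \<ominus> n = t \<oplus> \<one>" unfolding t_eq using n by algebra
    finally have "\<six> \<oplus> n \<otimes> (n \<ominus> (\<two> \<oplus> \<three>)) = t \<otimes> (t \<oplus> \<one>)"
      unfolding t_eq[symmetric] .
    also have "\<ominus> \<dots> = \<ominus> t \<ominus> \<ominus> t \<otimes> \<ominus> t" using t by algebra
    finally show ?thesis .
  qed
  ultimately have "\<ominus> t \<ominus> \<ominus> t \<otimes> \<ominus> t \<in> nilpotents R" by simp
  then obtain e x where e: "e \<in> idempotents R" and x: "x \<in> carrier R" and ex: "e = \<ominus> t \<otimes> x"
      and en: "\<ominus> t \<ominus> e \<in> nilpotents R"
    using lift_idempotent[of "\<ominus> t"] by (metis a_inv_closed t)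
  have "e = t \<otimes> (\<ominus> x)" using ex x by (simp add: l_minus r_minus)
  then have "e = \<zero>" using none[of "\<ominus> x"] e x by simp
  then have "\<ominus> t \<in> nilpotents R" using en by (simp add: minus_eq)
  then show ?thesis using nilpotent_uminus[of "\<ominus> t"] by simp
qed

text \<open>For \<open>t \<in> bR\<close> the exchange property can only choose the idempotent 0, so \<open>1 - t\<close> or \<open>1 + t\<close> is
  right invertible, hence a unit. By the condition on units, \<open>t\<close> is nilpotent or within a nilpotent
  of 2 or \<open>- 2\<close>; the latter cases are covered by the previous lemma.\<close>
lemma nilradical_if_no_idempotent:
  assumes b [simp]: "b \<in> carrier R"
    and none: "\<And>x. x \<in> carrier R \<Longrightarrow> b \<otimes> x \<in> idempotents R \<Longrightarrow> b \<otimes> x = \<zero>"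
  shows "b \<in> nilradical"
proof (rule nilradicalI)
  have right_unit: "b \<otimes> r \<in> nilpotents R"
    if r [simp]: "r \<in> carrier R" and y: "y \<in> carrier R" and ry: "(\<one> \<ominus> b \<otimes> r) \<otimes> y = \<one>" for r y
  proof -
    have none': "b \<otimes> r \<otimes> x = \<zero>" if "x \<in> carrier R" "b \<otimes> r \<otimes> x \<in> idempotents R" for x
      using none[of "r \<otimes> x"] that by (simp add: m_assoc)
    have "y \<otimes> (\<one> \<ominus> b \<otimes> r) = \<one>"
      by (rule left_inverse_if_right_inverse[OF _ y ry]) simp
    then have "\<one> \<ominus> b \<otimes> r \<in> Units R"
      using ry y unfolding Units_def by auto
    then have "\<one> \<ominus> b \<otimes> r \<ominus> \<one> \<in> nilpotents R \<or> \<one> \<ominus> b \<otimes> r \<oplus> \<one> \<in> nilpotents R"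
      by (rule unit_cases)
    moreover have "b \<otimes> r = \<ominus> (\<one> \<ominus> b \<otimes> r \<ominus> \<one>)" "\<two> \<ominus> b \<otimes> r = \<one> \<ominus> b \<otimes> r \<oplus> \<one>"
      using b r by algebra+
    ultimately have "b \<otimes> r \<in> nilpotents R \<or> \<two> \<ominus> b \<otimes> r \<in> nilpotents R"
      using nilpotent_uminus by metis
    then show ?thesis
      using nilpotent_if_near_two[of "b \<otimes> r"] none' by auto
  qed
  fix r assume r [simp]: "r \<in> carrier R"
  obtain e x y where e: "e \<in> idempotents R" and x: "x \<in> carrier R" and y: "y \<in> carrier R"
    and ex: "e = b \<otimes> r \<otimes> x" and ey: "\<one> \<ominus> e = (\<one> \<ominus> b \<otimes> r) \<otimes> y \<or> \<one> \<ominus> e = (\<one> \<oplus> b \<otimes> r) \<otimes> y"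
    by (rule exchange[of "b \<otimes> r"]) simp_all
  have "e = \<zero>" using none[of "r \<otimes> x"] e x ex by (simp add: m_assoc)
  then have one: "\<one> \<ominus> e = \<one>" by (simp add: minus_eq)
  from ey show "b \<otimes> r \<in> nilpotents R"
  proof
    assume "\<one> \<ominus> e = (\<one> \<ominus> b \<otimes> r) \<otimes> y"
    then show ?thesis using right_unit[OF r y] one by simp
  next
    assume "\<one> \<ominus> e = (\<one> \<oplus> b \<otimes> r) \<otimes> y"
    moreover have "\<one> \<oplus> b \<otimes> r = \<one> \<ominus> b \<otimes> (\<ominus> r)" using b r by algebra
    ultimately have "b \<otimes> (\<ominus> r) \<in> nilpotents R"
      using right_unit[of "\<ominus> r", OF _ y] one by simp
    then show ?thesis using nilpotent_uminus[of "b \<otimes> (\<ominus> r)"] by (simp add: r_minus)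
  qed
qed simp

section \<open>The nilpotents form an ideal\<close>

text \<open>An idempotent \<open>e = (b + c) x\<close> vanishes because \<open>1 - e\<close> is a unit:
  with the unit \<open>v = 1 - b x\<close> one has \<open>1 - e = v (1 - v\<inverse> c x)\<close>, and \<open>v\<inverse> c x\<close> is nilpotent.\<close>
lemma nilradical_add:
  assumes b: "b \<in> nilradical" and c: "c \<in> nilradical"
  shows "b \<oplus> c \<in> nilradical"
proof (rule nilradical_if_no_idempotent)
  note [simp] = nilradical_closed[OF b] nilradical_closed[OF c]
  fix x assume x [simp]: "x \<in> carrier R" and e: "(b \<oplus> c) \<otimes> x \<in> idempotents R"
  define v where "v = \<one> \<ominus> b \<otimes> x"
  have v: "v \<in> Units R"
    unfolding v_def by (rule one_minus_nilpotent[OF nilradicalD[OF b x]])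
  then have [simp]: "v \<in> carrier R" "inv v \<in> carrier R" by (rule Units_closed, rule Units_inv_closed)
  have "inv v \<otimes> c \<otimes> x \<in> nilpotents R"
    by (rule nilradicalD[OF nilradical_mult_left[OF c] x]) simp
  then have "v \<otimes> (\<one> \<ominus> inv v \<otimes> c \<otimes> x) \<in> Units R"
    using one_minus_nilpotent v by simp
  moreover have "v \<otimes> (\<one> \<ominus> inv v \<otimes> c \<otimes> x) = v \<ominus> v \<otimes> inv v \<otimes> (c \<otimes> x)"
    by (simp add: r_distr minus_eq r_minus m_assoc)
  moreover have "\<dots> = v \<ominus> c \<otimes> x" using v by simp
  moreover have "\<dots> = \<one> \<ominus> (b \<oplus> c) \<otimes> x"
    unfolding v_def by (simp add: ring_simprules)
  ultimately have "\<one> \<ominus> (b \<oplus> c) \<otimes> x \<in> Units R" by simp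
  then have one: "\<one> \<ominus> (b \<oplus> c) \<otimes> x = \<one>"
    by (rule unit_idempotent_eq_one[OF idempotent_complement[OF e]])
  define w where "w = (b \<oplus> c) \<otimes> x"
  have "w \<in> carrier R" unfolding w_def by simp
  then have "w = \<one> \<ominus> (\<one> \<ominus> w)" by algebra
  also have "\<dots> = \<zero>" using one unfolding w_def by (simp add: minus_eq r_neg)
  finally show "(b \<oplus> c) \<otimes> x = \<zero>" unfolding w_def .
qed (use b c in simp)

lemma nilradical_diff: "\<lbrakk>b \<in> nilradical; c \<in> nilradical\<rbrakk> \<Longrightarrow> b \<ominus> c \<in> nilradical"
  by (simp add: minus_eq nilradical_add nilradical_uminus)

lemma square_zero_nilradical: "\<lbrakk>b \<in> carrier R; b \<otimes> b = \<zero>\<rbrakk> \<Longrightarrow> b \<in> nilradical"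
  using nilradical_if_no_idempotent square_zero_no_idempotent by blast

text \<open>The argument for square zero elements, carried out modulo the nilradical: an idempotent
  \<open>e = n x\<close> is the product of two Peirce parts of square zero up to a multiple of \<open>n\<^sup>2\<close>, so \<open>e\<close> lies
  in the nilradical.\<close>
lemma nilradical_of_square:
  assumes n [simp]: "n \<in> carrier R" and nn: "n \<otimes> n \<in> nilradical"
  shows "n \<in> nilradical"
proof (rule nilradical_if_no_idempotent[OF n])
  fix x assume x [simp]: "x \<in> carrier R" and eI: "n \<otimes> x \<in> idempotents R"
  define e where "e = n \<otimes> x"
  have ec [simp]: "e \<in> carrier R" unfolding e_def by simp
  let ?p = "e \<otimes> n \<otimes> (\<one> \<ominus> e)" and ?q = "(\<one> \<ominus> e) \<otimes> x \<otimes> e"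
  let ?w = "e \<otimes> (n \<otimes> n \<otimes> (x \<otimes> x \<otimes> e))"
  have "?p \<in> nilradical"
    using eI peirce_square_zero(1)[of e n] unfolding e_def by (intro square_zero_nilradical) simp_all
  then have "?p \<otimes> ?q \<in> nilradical" by (rule nilradical_mult_right) simp
  moreover have "?w \<in> nilradical"
    by (intro nilradical_mult_left nilradical_mult_right nn) simp_all
  ultimately have "?p \<otimes> ?q \<oplus> ?w \<in> nilradical" by (rule nilradical_add)
  moreover have "?p \<otimes> ?q \<oplus> ?w = e"
  proof -
    have "?p \<otimes> ?q = e \<ominus> ?w"
      using peirce_corner_product[OF n x eI] unfolding e_def .
    moreover have "e \<ominus> ?w \<oplus> ?w = e"
      by (simp add: minus_eq a_assoc l_neg)
    ultimately show ?thesis by simp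
  qed
  ultimately have "e \<in> nilpotents R" using nilradical_nilpotent by simp
  then show "n \<otimes> x = \<zero>" using nilpotent_idempotent_eq_zero eI e_def by blast
qed

text \<open>Repeated squaring reaches 0.\<close>
lemma nilpotent_in_nilradical:
  assumes "n \<in> nilpotents R"
  shows "n \<in> nilradical"
proof -
  have *: "n \<in> nilradical" if "n \<in> carrier R" "n [^] ((2::nat) ^ k) = \<zero>" for k n
    using that
  proof (induction k arbitrary: n)
    case 0
    then have "n = \<zero>" by simp
    then show ?case using square_zero_nilradical[of n] by simp
  next
    case (Suc k)
    have "(n \<otimes> n) [^] ((2::nat) ^ k) = n [^] ((2::nat) ^ Suc k)"
      using nat_pow_pow[of n 2 "2 ^ k"] Suc.prems(1) by (simp add: numeral_2_eq_2)
    then have "n \<otimes> n \<in> nilradical"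
      using Suc.IH[of "n \<otimes> n"] Suc.prems by (simp only: m_closed)
    then show ?case by (rule nilradical_of_square[OF Suc.prems(1)])
  qed
  obtain m :: nat where m: "n [^] Suc m = \<zero>" using nilpotents_Suc assms .
  have "Suc m \<le> 2 ^ Suc m" using less_exp[of "Suc m"] by simp
  then have "n [^] ((2::nat) ^ Suc m) = n [^] Suc m \<otimes> n [^] (2 ^ Suc m - Suc m)"
    using nat_pow_mult[of n "Suc m" "2 ^ Suc m - Suc m"] assms by simp
  also have "\<dots> = \<zero>" unfolding m using assms by simp
  finally show ?thesis using *[of n "Suc m"] nilpotents_closed[OF assms] by blast
qed

section \<open>Decomposition of every element\<close>

text \<open>The next two lemmas express that the polynomials \<open>t + t\<^sup>2\<close> and \<open>t - t\<^sup>2\<close> may be evaluated modulo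
  the nilradical.\<close>
lemma square_plus_self_shift:
  assumes n: "n \<in> nilradical" and c: "c \<in> carrier R" and cc: "c \<oplus> c \<otimes> c \<in> nilradical"
  shows "(n \<oplus> c) \<oplus> (n \<oplus> c) \<otimes> (n \<oplus> c) \<in> nilradical"
proof -
  have nc: "n \<in> carrier R" using n by simp
  have "n \<otimes> (n \<oplus> c) \<oplus> c \<otimes> n \<oplus> n \<oplus> (c \<oplus> c \<otimes> c) \<in> nilradical"
    using nc c by (intro nilradical_add nilradical_mult_right nilradical_mult_left n cc) simp_all
  moreover have "n \<otimes> (n \<oplus> c) \<oplus> c \<otimes> n \<oplus> n \<oplus> (c \<oplus> c \<otimes> c) = (n \<oplus> c) \<oplus> (n \<oplus> c) \<otimes> (n \<oplus> c)"
    using nc c by algebra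
  ultimately show ?thesis by simp
qed

lemma self_minus_square_shift:
  assumes n: "n \<in> nilradical" and c: "c \<in> carrier R" and cc: "c \<ominus> c \<otimes> c \<in> nilradical"
  shows "(n \<oplus> c) \<ominus> (n \<oplus> c) \<otimes> (n \<oplus> c) \<in> nilradical"
proof -
  have nc: "n \<in> carrier R" using n by simp
  have "n \<ominus> (n \<otimes> (n \<oplus> c) \<oplus> c \<otimes> n) \<oplus> (c \<ominus> c \<otimes> c) \<in> nilradical"
    using nc c by (intro nilradical_add nilradical_diff nilradical_mult_right nilradical_mult_left n cc) simp_all
  moreover have "n \<ominus> (n \<otimes> (n \<oplus> c) \<oplus> c \<otimes> n) \<oplus> (c \<ominus> c \<otimes> c) = (n \<oplus> c) \<ominus> (n \<oplus> c) \<otimes> (n \<oplus> c)"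
    using nc c by algebra
  ultimately show ?thesis by simp
qed

text \<open>In an abelian ring \<open>x e - y (1 - e)\<close> would be inverse to \<open>a - (1 - e)\<close>. In general their product
  differs from 1 by off-diagonal Peirce parts, which lie in the nilradical.\<close>
lemma exchange_shift_unit:
  assumes a: "a \<in> carrier R" and e: "e \<in> idempotents R"
    and x: "x \<in> carrier R" and y: "y \<in> carrier R"
    and ex: "e = a \<otimes> x" and ey: "\<one> \<ominus> e = (\<one> \<ominus> a) \<otimes> y"
  shows "a \<ominus> (\<one> \<ominus> e) \<in> Units R"
proof -
  define f where "f = \<one> \<ominus> e"
  have fI: "f \<in> idempotents R" unfolding f_def by (rule idempotent_complement[OF e])
  have ec [simp]: "e \<in> carrier R" and fc [simp]: "f \<in> carrier R" using e fI by simp_all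
  note [simp] = a x y
  have ee: "e \<otimes> e = e" and ff: "f \<otimes> f = f" using e fI idempotents_idem by blast+
  have ay: "a \<otimes> y = y \<ominus> f"
    unfolding f_def ey using a y by algebra
  have e_eq: "e = \<one> \<ominus> f" unfolding f_def using ec by algebra
  define w where "w = x \<otimes> e \<ominus> y \<otimes> f"
  define j where "j = e \<otimes> y \<otimes> f \<oplus> f \<otimes> x \<otimes> e"
  have wc [simp]: "w \<in> carrier R" unfolding w_def by simp
  have "e \<otimes> y \<otimes> f \<in> nilradical" "f \<otimes> x \<otimes> e \<in> nilradical"
    unfolding f_def using peirce_square_zero[OF e] by (auto intro!: square_zero_nilradical)
  then have jK: "j \<in> nilradical" unfolding j_def by (rule nilradical_add)
  then have jc [simp]: "j \<in> carrier R" by simp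
  have "(a \<ominus> f) \<otimes> w = a \<otimes> x \<otimes> e \<ominus> a \<otimes> y \<otimes> f \<ominus> f \<otimes> x \<otimes> e \<oplus> f \<otimes> y \<otimes> f"
    unfolding w_def using a fc ec x y by algebra
  also have "\<dots> = e \<ominus> (y \<ominus> f) \<otimes> f \<ominus> f \<otimes> x \<otimes> e \<oplus> f \<otimes> y \<otimes> f"
    unfolding ex[symmetric] ay ee ..
  also have "\<dots> = e \<oplus> f \<otimes> f \<ominus> ((\<one> \<ominus> f) \<otimes> y \<otimes> f \<oplus> f \<otimes> x \<otimes> e)"
    using fc ec x y by algebra
  also have "\<dots> = e \<oplus> f \<ominus> j" unfolding ff e_eq[symmetric] j_def ..
  also have "e \<oplus> f = \<one>" unfolding f_def using ec by algebra
  finally have uw: "(a \<ominus> f) \<otimes> w = \<one> \<ominus> j" .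
  have unit: "\<one> \<ominus> j \<in> Units R" by (rule one_minus_nilpotent[OF nilradical_nilpotent[OF jK]])
  then have ic [simp]: "inv (\<one> \<ominus> j) \<in> carrier R" by (rule Units_inv_closed)
  have right: "(a \<ominus> f) \<otimes> (w \<otimes> inv (\<one> \<ominus> j)) = \<one>"
    using uw unit by (simp add: m_assoc[symmetric])
  then have "(w \<otimes> inv (\<one> \<ominus> j)) \<otimes> (a \<ominus> f) = \<one>"
    by (rule left_inverse_if_right_inverse[rotated 2]) simp_all
  moreover have "w \<otimes> inv (\<one> \<ominus> j) \<in> carrier R" "a \<ominus> f \<in> carrier R" by simp_all
  ultimately have "a \<ominus> f \<in> Units R" using right unfolding Units_def by blast
  then show ?thesis unfolding f_def .
qed

text \<open>Modulo the nilradical, the condition on units gives \<open>a = - e\<close>, where \<open>a + a\<^sup>2 = 0\<close>, or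
  \<open>a = 2 - e\<close>, where \<open>a + a\<^sup>2 = 6 - 4 e\<close> and \<open>a - a\<^sup>2 = - 2 (1 - e)\<close>. As 6 is nilpotent, either
  alternative for the idempotent \<open>e\<close> kills one of the last two.\<close>
lemma square_nilpotent_if_shift_unit:
  assumes a: "a \<in> carrier R" and e: "e \<in> idempotents R"
    and u: "a \<ominus> (\<one> \<ominus> e) \<in> Units R"
  shows "a \<oplus> a \<otimes> a \<in> nilpotents R \<or> a \<ominus> a \<otimes> a \<in> nilpotents R"
proof -
  have ec: "e \<in> carrier R" using e by simp
  have ee: "e \<otimes> e = e" by (rule idempotents_idem[OF e])
  from unit_cases[OF u] show ?thesis
  proof
    let ?n = "a \<ominus> (\<one> \<ominus> e) \<oplus> \<one>"
    assume "?n \<in> nilpotents R"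
    then have n: "?n \<in> nilradical" by (rule nilpotent_in_nilradical)
    have "\<ominus> e \<oplus> \<ominus> e \<otimes> \<ominus> e = e \<otimes> e \<ominus> e" using ec by algebra
    also have "\<dots> = \<zero>" unfolding ee using ec by algebra
    finally have "\<ominus> e \<oplus> \<ominus> e \<otimes> \<ominus> e \<in> nilradical"
      using square_zero_nilradical[of \<zero>] by simp
    then have "(?n \<oplus> \<ominus> e) \<oplus> (?n \<oplus> \<ominus> e) \<otimes> (?n \<oplus> \<ominus> e) \<in> nilradical"
      by (intro square_plus_self_shift n) (use ec in simp_all)
    moreover have "?n \<oplus> \<ominus> e = a" using a ec by algebra
    ultimately show ?thesis using nilradical_nilpotent by simp
  next
    let ?n = "a \<ominus> (\<one> \<ominus> e) \<ominus> \<one>" and ?c = "\<two> \<ominus> e"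
    assume "?n \<in> nilpotents R"
    then have n: "?n \<in> nilradical" by (rule nilpotent_in_nilradical)
    have c: "?c \<in> carrier R" using ec by simp
    have nc: "?n \<oplus> ?c = a" using a ec by algebra
    from idempotent_cases[OF e] show ?thesis
    proof
      assume "\<two> \<otimes> e \<in> nilpotents R"
      then have "\<two> \<otimes> e \<in> nilradical" by (rule nilpotent_in_nilradical)
      then have "\<six> \<ominus> (\<two> \<otimes> e \<oplus> \<two> \<otimes> e) \<in> nilradical"
        by (intro nilradical_diff nilradical_add nilpotent_in_nilradical[OF six_nilpotent])
      moreover have "?c \<oplus> ?c \<otimes> ?c = \<six> \<ominus> (\<two> \<otimes> e \<oplus> \<two> \<otimes> e)"
      proof -
        have "?c \<oplus> ?c \<otimes> ?c = \<six> \<ominus> (e \<oplus> e \<oplus> e \<oplus> e \<oplus> e) \<oplus> e \<otimes> e"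
          using ec by algebra
        also have "\<dots> = \<six> \<ominus> (\<two> \<otimes> e \<oplus> \<two> \<otimes> e)"
          unfolding ee using ec by algebra
        finally show ?thesis .
      qed
      ultimately have "?c \<oplus> ?c \<otimes> ?c \<in> nilradical" by simp
      from square_plus_self_shift[OF n c this] show ?thesis
        unfolding nc using nilradical_nilpotent by simp
    next
      assume "\<two> \<otimes> (\<one> \<ominus> e) \<in> nilpotents R"
      then have "\<two> \<otimes> (\<one> \<ominus> e) \<in> nilradical" by (rule nilpotent_in_nilradical)
      then have "\<ominus> (\<two> \<otimes> (\<one> \<ominus> e)) \<in> nilradical" by (rule nilradical_uminus)
      moreover have "?c \<ominus> ?c \<otimes> ?c = \<ominus> (\<two> \<otimes> (\<one> \<ominus> e))"
      proof -
        have "?c \<ominus> ?c \<otimes> ?c = \<ominus> \<two> \<oplus> (e \<oplus> e \<oplus> e) \<ominus> e \<otimes> e"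
          using ec by algebra
        also have "\<dots> = \<ominus> (\<two> \<otimes> (\<one> \<ominus> e))"
          unfolding ee using ec by algebra
        finally show ?thesis .
      qed
      ultimately have "?c \<ominus> ?c \<otimes> ?c \<in> nilradical" by simp
      from self_minus_square_shift[OF n c this] show ?thesis
        unfolding nc using nilradical_nilpotent by simp
    qed
  qed
qed

text \<open>If \<open>1 - e\<close> is a multiple of \<open>1 + a\<close> instead of \<open>1 - a\<close>, the data fit \<open>- a\<close>, and the
  disjunction is symmetric under this change of sign.\<close>
lemma square_nilpotent:
  assumes a: "a \<in> carrier R"
  shows "a \<oplus> a \<otimes> a \<in> nilpotents R \<or> a \<ominus> a \<otimes> a \<in> nilpotents R"
proof -
  obtain e x y where e: "e \<in> idempotents R" and x: "x \<in> carrier R" and y: "y \<in> carrier R"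
    and ex: "e = a \<otimes> x" and ey: "\<one> \<ominus> e = (\<one> \<ominus> a) \<otimes> y \<or> \<one> \<ominus> e = (\<one> \<oplus> a) \<otimes> y"
    by (rule exchange[OF a])
  from ey show ?thesis
  proof
    assume "\<one> \<ominus> e = (\<one> \<ominus> a) \<otimes> y"
    then show ?thesis by (rule square_nilpotent_if_shift_unit[OF a e exchange_shift_unit[OF a e x y ex]])
  next
    assume "\<one> \<ominus> e = (\<one> \<oplus> a) \<otimes> y"
    moreover have "e = \<ominus> a \<otimes> \<ominus> x" "\<one> \<oplus> a = \<one> \<ominus> \<ominus> a" using ex a x by algebra+
    ultimately have "\<ominus> a \<ominus> (\<one> \<ominus> e) \<in> Units R"
      by (intro exchange_shift_unit[of "\<ominus> a" e "\<ominus> x" y]) (use a e x y in simp_all)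
    then have "\<ominus> a \<oplus> \<ominus> a \<otimes> \<ominus> a \<in> nilpotents R \<or> \<ominus> a \<ominus> \<ominus> a \<otimes> \<ominus> a \<in> nilpotents R"
      by (intro square_nilpotent_if_shift_unit) (use a e in simp_all)
    moreover have "a \<ominus> a \<otimes> a = \<ominus> (\<ominus> a \<oplus> \<ominus> a \<otimes> \<ominus> a)" "a \<oplus> a \<otimes> a = \<ominus> (\<ominus> a \<ominus> \<ominus> a \<otimes> \<ominus> a)"
      using a by algebra+
    ultimately show ?thesis using nilpotent_uminus by metis
  qed
qed

lemma strongly_weakly_nil_clean: "strongly_weakly_nil_clean R"
  unfolding strongly_weakly_nil_clean_def
proof
  fix a assume a: "a \<in> carrier R"
  from square_nilpotent[OF a]
  show "\<exists>w \<in> nilpotents R. \<exists>e \<in> idempotents R.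
      w \<otimes> e = e \<otimes> w \<and> (a = w \<oplus> e \<or> a = w \<ominus> e)"
  proof
    assume "a \<ominus> a \<otimes> a \<in> nilpotents R"
    from lift_idempotent[OF a this] obtain e where e: "e \<in> idempotents R"
      and ae: "a \<otimes> e = e \<otimes> a" and w: "a \<ominus> e \<in> nilpotents R" .
    have ec: "e \<in> carrier R" using e by simp
    have "(a \<ominus> e) \<otimes> e = a \<otimes> e \<ominus> e \<otimes> e" using a ec by algebra
    also have "\<dots> = e \<otimes> (a \<ominus> e)" unfolding ae using a ec by algebra
    finally have "(a \<ominus> e) \<otimes> e = e \<otimes> (a \<ominus> e)" .
    moreover have "a = (a \<ominus> e) \<oplus> e" using a ec by algebra
    ultimately show ?thesis using e w by blast
  next
    assume "a \<oplus> a \<otimes> a \<in> nilpotents R"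
    then have "\<ominus> (a \<oplus> a \<otimes> a) \<in> nilpotents R" by (rule nilpotent_uminus)
    moreover have "\<ominus> (a \<oplus> a \<otimes> a) = \<ominus> a \<ominus> \<ominus> a \<otimes> \<ominus> a" using a by algebra
    ultimately have "\<ominus> a \<ominus> \<ominus> a \<otimes> \<ominus> a \<in> nilpotents R" by simp
    from lift_idempotent[OF a_inv_closed[OF a] this] obtain e where e: "e \<in> idempotents R"
      and ae: "\<ominus> a \<otimes> e = e \<otimes> \<ominus> a" and w: "\<ominus> a \<ominus> e \<in> nilpotents R" .
    have ec: "e \<in> carrier R" using e by simp
    have "\<ominus> (\<ominus> a \<ominus> e) \<otimes> e = e \<otimes> e \<ominus> \<ominus> a \<otimes> e" using a ec by algebra
    also have "\<dots> = e \<otimes> \<ominus> (\<ominus> a \<ominus> e)" unfolding ae using a ec by algebra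
    finally have "\<ominus> (\<ominus> a \<ominus> e) \<otimes> e = e \<otimes> \<ominus> (\<ominus> a \<ominus> e)" .
    moreover have "a = \<ominus> (\<ominus> a \<ominus> e) \<ominus> e" using a ec by algebra
    ultimately show ?thesis using e nilpotent_uminus[OF w] by blast
  qed
qed

end

section \<open>Exchange and units in strongly weakly nil-clean rings\<close>

context ring
begin

text \<open>From \<open>(w + e) e = e (1 + w)\<close> and \<open>(1 - w - e) (1 - e) = (1 - e) (1 - w)\<close>.\<close>
lemma exchange_witness:
  assumes w: "w \<in> nilpotents R" and e: "e \<in> idempotents R" and we: "w \<otimes> e = e \<otimes> w"
  shows "\<exists>x \<in> carrier R. e = (w \<oplus> e) \<otimes> x"
    and "\<exists>y \<in> carrier R. \<one> \<ominus> e = (\<one> \<ominus> (w \<oplus> e)) \<otimes> y"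
proof -
  have wc [simp]: "w \<in> carrier R" and ec [simp]: "e \<in> carrier R" using w e by simp_all
  have ee: "e \<otimes> e = e" by (rule idempotents_idem[OF e])
  have p: "\<one> \<oplus> w \<in> Units R" and m: "\<one> \<ominus> w \<in> Units R"
    using one_plus_nilpotent[OF w] one_minus_nilpotent[OF w] by blast+
  have [simp]: "inv (\<one> \<oplus> w) \<in> carrier R" "inv (\<one> \<ominus> w) \<in> carrier R"
    using Units_inv_closed[OF p] Units_inv_closed[OF m] by blast+
  have "(w \<oplus> e) \<otimes> e = w \<otimes> e \<oplus> e \<otimes> e" using wc ec by algebra
  also have "\<dots> = e \<otimes> (\<one> \<oplus> w)" unfolding we ee using wc ec by algebra
  finally have "(w \<oplus> e) \<otimes> (e \<otimes> inv (\<one> \<oplus> w)) = e \<otimes> (\<one> \<oplus> w) \<otimes> inv (\<one> \<oplus> w)"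
    by (simp add: m_assoc[symmetric])
  also have "\<dots> = e" using p by (simp add: m_assoc)
  finally show "\<exists>x \<in> carrier R. e = (w \<oplus> e) \<otimes> x"
    by (intro bexI[of _ "e \<otimes> inv (\<one> \<oplus> w)"]) simp_all
  have "(\<one> \<ominus> (w \<oplus> e)) \<otimes> (\<one> \<ominus> e) = \<one> \<ominus> w \<ominus> e \<ominus> e \<oplus> w \<otimes> e \<oplus> e \<otimes> e" using wc ec by algebra
  also have "\<dots> = (\<one> \<ominus> e) \<otimes> (\<one> \<ominus> w)" unfolding we ee using wc ec by algebra
  finally have "(\<one> \<ominus> (w \<oplus> e)) \<otimes> ((\<one> \<ominus> e) \<otimes> inv (\<one> \<ominus> w)) = (\<one> \<ominus> e) \<otimes> (\<one> \<ominus> w) \<otimes> inv (\<one> \<ominus> w)"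
    by (simp add: m_assoc[symmetric])
  also have "\<dots> = \<one> \<ominus> e" using m by (simp add: m_assoc)
  finally show "\<exists>y \<in> carrier R. \<one> \<ominus> e = (\<one> \<ominus> (w \<oplus> e)) \<otimes> y"
    by (intro bexI[of _ "(\<one> \<ominus> e) \<otimes> inv (\<one> \<ominus> w)"]) simp_all
qed

lemma weakly_exchange_if_strongly_weakly_nil_clean:
  assumes "strongly_weakly_nil_clean R"
  shows "weakly_exchange R"
  unfolding weakly_exchange_def
proof
  fix a assume a: "a \<in> carrier R"
  obtain w e where w: "w \<in> nilpotents R" and e: "e \<in> idempotents R" and we: "w \<otimes> e = e \<otimes> w"
    and a_eq: "a = w \<oplus> e \<or> a = w \<ominus> e"
    using assms a unfolding strongly_weakly_nil_clean_def by blast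
  have wc: "w \<in> carrier R" and ec: "e \<in> carrier R" using w e by simp_all
  have "\<exists>x \<in> carrier R. e = a \<otimes> x"
    and "\<exists>y \<in> carrier R. \<one> \<ominus> e = (\<one> \<ominus> a) \<otimes> y \<or> \<one> \<ominus> e = (\<one> \<oplus> a) \<otimes> y"
  proof -
    show "\<exists>x \<in> carrier R. e = a \<otimes> x"
      using a_eq
    proof
      assume "a = w \<oplus> e" then show ?thesis using exchange_witness(1)[OF w e we] by simp
    next
      assume eq: "a = w \<ominus> e"
      have "\<ominus> w \<otimes> e = e \<otimes> \<ominus> w" using we wc ec by (simp add: l_minus r_minus)
      then obtain x where x: "x \<in> carrier R" "e = (\<ominus> w \<oplus> e) \<otimes> x"
        using exchange_witness(1)[OF nilpotent_uminus[OF w] e] by blast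
      have "(\<ominus> w \<oplus> e) \<otimes> x = a \<otimes> (\<ominus> x)" unfolding eq using wc ec x(1) by algebra
      then show ?thesis using x by (intro bexI[of _ "\<ominus> x"]) simp_all
    qed
    show "\<exists>y \<in> carrier R. \<one> \<ominus> e = (\<one> \<ominus> a) \<otimes> y \<or> \<one> \<ominus> e = (\<one> \<oplus> a) \<otimes> y"
      using a_eq
    proof
      assume "a = w \<oplus> e" then show ?thesis using exchange_witness(2)[OF w e we] by blast
    next
      assume eq: "a = w \<ominus> e"
      have "\<ominus> w \<otimes> e = e \<otimes> \<ominus> w" using we wc ec by (simp add: l_minus r_minus)
      then obtain y where y: "y \<in> carrier R" "\<one> \<ominus> e = (\<one> \<ominus> (\<ominus> w \<oplus> e)) \<otimes> y"
        using exchange_witness(2)[OF nilpotent_uminus[OF w] e] by blast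
      moreover have "\<one> \<ominus> (\<ominus> w \<oplus> e) = \<one> \<oplus> a" unfolding eq using wc ec by algebra
      ultimately show ?thesis by auto
    qed
  qed
  then show "\<exists>e \<in> idempotents R. e \<in> a <# carrier R \<and>
      \<one> \<ominus> e \<in> ((\<one> \<ominus> a) <# carrier R) \<union> ((\<one> \<oplus> a) <# carrier R)"
    using e unfolding l_coset_def by blast
qed

text \<open>A unit \<open>u = w + e\<close> or \<open>u = w - e\<close> commutes with \<open>w\<close>, so \<open>u - w\<close> is a unit as well; being \<open>e\<close> or
  \<open>- e\<close>, it forces \<open>e = 1\<close>.\<close>
lemma WUU_if_strongly_weakly_nil_clean:
  assumes "strongly_weakly_nil_clean R"
  shows "WUU R"
  unfolding WUU_def
proof
  fix u assume u: "u \<in> Units R"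
  then have uc [simp]: "u \<in> carrier R" and ic [simp]: "inv u \<in> carrier R"
    by (rule Units_closed, rule Units_inv_closed)
  obtain w e where w: "w \<in> nilpotents R" and e: "e \<in> idempotents R" and we: "w \<otimes> e = e \<otimes> w"
    and u_eq: "u = w \<oplus> e \<or> u = w \<ominus> e"
    using assms uc unfolding strongly_weakly_nil_clean_def by blast
  have wc [simp]: "w \<in> carrier R" and ec [simp]: "e \<in> carrier R" using w e by simp_all
  have uw: "w \<otimes> u = u \<otimes> w"
    using u_eq we by (auto simp: l_distr r_distr l_minus r_minus minus_eq)
  have iw: "w \<otimes> inv u = inv u \<otimes> w"
  proof -
    have "inv u \<otimes> (w \<otimes> u) \<otimes> inv u = inv u \<otimes> w"
      using u by (simp add: m_assoc)
    then show ?thesis unfolding uw using u by (simp add: m_assoc[symmetric])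
  qed
  have unit: "u \<ominus> w \<in> Units R"
  proof -
    have "w \<otimes> inv u \<in> nilpotents R" by (rule nilpotent_mult_commuting[OF w ic iw])
    then have "(\<one> \<ominus> w \<otimes> inv u) \<otimes> u \<in> Units R" using one_minus_nilpotent u by simp
    moreover have "(\<one> \<ominus> w \<otimes> inv u) \<otimes> u = u \<ominus> w \<otimes> (inv u \<otimes> u)" using uc ic wc by algebra
    ultimately show ?thesis using u by simp
  qed
  from u_eq show "u \<in> \<one> <+ nilpotents R \<or> u \<in> (\<ominus> \<one>) <+ nilpotents R"
  proof
    assume eq: "u = w \<oplus> e"
    have "u \<ominus> w = e" unfolding eq using wc ec by algebra
    then have "e = \<one>" using unit unit_idempotent_eq_one[OF e] by simp
    then have "u = \<one> \<oplus> w" using eq by (simp add: a_comm)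
    then show ?thesis using w unfolding a_l_coset_def' by blast
  next
    assume eq: "u = w \<ominus> e"
    have "\<ominus> (u \<ominus> w) = e" unfolding eq using wc ec by algebra
    moreover have "\<ominus> (u \<ominus> w) \<in> Units R" using unit Units_minus_one_closed
      by (metis Units_closed Units_m_closed l_minus l_one one_closed)
    ultimately have "e = \<one>" using unit_idempotent_eq_one[OF e] by simp
    then have "u = \<ominus> \<one> \<oplus> w" using eq by (simp add: minus_eq a_comm)
    then show ?thesis using w unfolding a_l_coset_def' by blast
  qed
qed

end

section \<open>The characterization\<close>

theorem theorem3p6:
  fixes R (structure)
  assumes "ring R"
  shows "strongly_weakly_nil_clean R \<longleftrightarrow> weakly_exchange R \<and> WUU R"
proof
  interpret ring R by (rule assms)
  assume "strongly_weakly_nil_clean R"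
  then show "weakly_exchange R \<and> WUU R"
    using weakly_exchange_if_strongly_weakly_nil_clean WUU_if_strongly_weakly_nil_clean by blast
next
  assume "weakly_exchange R \<and> WUU R"
  then interpret weakly_exchange_WUU_ring R
    using assms by (intro weakly_exchange_WUU_ring.intro weakly_exchange_WUU_ring_axioms.intro) simp_all
  show "strongly_weakly_nil_clean R" by (rule strongly_weakly_nil_clean)
qed

end
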